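(* Let $d\ge 2$ and let $K\subset\mathbb{R}^d$ be a bounded, not necessarily convex, polytope with nonempty interior. Let $f$ be a polynomial-in-momentum first integral of the Birkhoff billiard in $K$. Then $f$ is independent of the position: there is a polynomial $Q$ on $\mathbb{R}^d$ such that $$f(q,p)=Q(p)\qquad\text{for all } q\in\operatorname{int}K,\ p\in\mathbb{R}^d .$$ Consequently, if $G_K\subset O(d)$ denotes the closed group generated by the linear reflections in the facets of $K$ (i.e. the closure in $O(d)$ of the group generated by the maps $p\mapsto p-2\langle p,n\rangle n$, where $n$ runs over the unit normals to the facets of $K$), then $Q$ is $G_K$-invariant, i.e. $Q(gp)=Q(p)$ for all $g\in G_K$, $p\in\mathbb{R}^d$. In particular, if $G_K=O(d)$, then $f$ is a polynomial in the kinetic energy $H(p)=\tfrac12\|p\|^2$.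
   Context: Polytopes. A convex polytope is a set $\{x\in\mathbb{R}^d:\ell_j(x)\le 0,\ 1\le j\le m\}$ for irredundant affine linear functions $\ell_1,\dots,\ell_m$; its facets are its intersections with the hyperplanes $\{\ell_j=0\}$. A (not necessarily convex) polytope is a finite union of convex polytopes whose interior is connected. Regular points and facets. Write $U=\operatorname{int}K$. A boundary point $x$ of $U$ is regular, with unit normal $n$, if for some small ball $B$ centered at $x$ the set $U\cap B$ is one of the two open half-balls cut from $B$ by the hyperplane through $x$ orthogonal to $n$. The hyperplanes containing the facets of $K$ are the hyperplanes obtained in this way from regular boundary points; the unit normals to the facets are the corresponding vectors $\pm n$. Billiard dynamics. A point with position $q\in U$ and momentum $p\in\mathbb{R}^d$ moves freely ($\dot q=p$, $\dot p=0$) inside $U$, and at a regular boundary point with unit normal $n$ its momentum changes by $p\mapsto p-2\langle p,n\rangle n$. First integrals. A first integral is a function $f:U\times\mathbb{R}^d\to\mathbb{R}$ constant along billiard trajectories, that is: (i) $f(q+tp,p)=f(q,p)$ whenever the segment from $q$ to $q+tp$ is contained in $U$; (ii) if $q+sp\in U$ for $0\le s<t_1$ (with $t_1>0$), $x=q+t_1p$ is a regular boundary point with unit normal $n$, $\langle p,n\rangle\ne0$, $p'=p-2\langle p,n\rangle n$, and $x+sp'\in U$ for $0<s\le t_2$ (with $t_2>0$), then $f(x+t_2p',p')=f(q,p)$. It is polynomial-in-momentum if $f(q,p)=\sum_{|\alpha|\le r}a_\alpha(q)p^\alpha$ for some $r$ and some functions $a_\alpha:U\to\mathbb{R}$, with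 no regularity assumption on the coefficients $a_\alpha$. *)

theory Defs
  imports "HOL-Analysis.Analysis" "HOL-Algebra.Generated_Groups"
begin

(* A convex polytope, possibly unbounded, is a finite intersection of closed affine half-spaces, i.e. a
   library polyhedron. A finite system of affine inequalities always has an irredundant subsystem with
   the same solution set, so irredundancy does not restrict the class of sets. The library constant
   polytope means a convex hull of finitely many points. *)
definition nonconvex_polytope :: "'a::euclidean_space set \<Rightarrow> bool" where
  "nonconvex_polytope K \<longleftrightarrow>
     (\<exists>\<C>. finite \<C> \<and> (\<forall>C\<in>\<C>. polyhedron C) \<and> K = \<Union>\<C>) \<and> connected (interior K)"

definition regular_boundary_point :: "'a::euclidean_space set \<Rightarrow> 'a \<Rightarrow> 'a \<Rightarrow> bool" where
  "regular_boundary_point U x n \<longleftrightarrow>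
     x \<in> frontier U \<and> norm n = 1 \<and>
     (\<exists>e>0. U \<inter> ball x e = {y \<in> ball x e. n \<bullet> (y - x) < 0} \<or>
            U \<inter> ball x e = {y \<in> ball x e. n \<bullet> (y - x) > 0})"

definition reflect :: "'a::real_inner \<Rightarrow> 'a \<Rightarrow> 'a" where
  "reflect n p = p - (2 * (p \<bullet> n)) *\<^sub>R n"

definition first_integral :: "'a::euclidean_space set \<Rightarrow> ('a \<Rightarrow> 'a \<Rightarrow> real) \<Rightarrow> bool" where
  "first_integral U f \<longleftrightarrow>
     (\<forall>q p t. closed_segment q (q + t *\<^sub>R p) \<subseteq> U \<longrightarrow> f (q + t *\<^sub>R p) p = f q p) \<and>
     (\<forall>q p t1 t2 x n p'.
        t1 > 0 \<longrightarrow> (\<forall>s. 0 \<le> s \<and> s < t1 \<longrightarrow> q + s *\<^sub>R p \<in> U) \<longrightarrow>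
        x = q + t1 *\<^sub>R p \<longrightarrow> regular_boundary_point U x n \<longrightarrow> p \<bullet> n \<noteq> 0 \<longrightarrow>
        p' = reflect n p \<longrightarrow>
        t2 > 0 \<longrightarrow> (\<forall>s. 0 < s \<and> s \<le> t2 \<longrightarrow> x + s *\<^sub>R p' \<in> U) \<longrightarrow>
        f (x + t2 *\<^sub>R p') p' = f q p)"

lemma finite_multi_indices: "finite {\<alpha> :: 'n::finite \<Rightarrow> nat. sum \<alpha> UNIV \<le> r}"
proof (rule finite_subset)
  show "{\<alpha> :: 'n \<Rightarrow> nat. sum \<alpha> UNIV \<le> r} \<subseteq> Pi\<^sub>E UNIV (\<lambda>_. {..r})"
  proof (clarsimp simp: PiE_UNIV_domain)
    fix \<alpha> :: "'n \<Rightarrow> nat" and i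
    assume "sum \<alpha> UNIV \<le> r"
    moreover have "\<alpha> i \<le> sum \<alpha> UNIV"
      by (rule member_le_sum) simp_all
    ultimately show "\<alpha> i \<le> r" by linarith
  qed
  show "finite (Pi\<^sub>E (UNIV :: 'n set) (\<lambda>_. {..r}))"
    by (rule finite_PiE) auto
qed

definition polynomial_in_momentum ::
    "(real^'n) set \<Rightarrow> (real^'n \<Rightarrow> real^'n \<Rightarrow> real) \<Rightarrow> bool" where
  "polynomial_in_momentum U f \<longleftrightarrow>
     (\<exists>(r::nat) (a :: ('n \<Rightarrow> nat) \<Rightarrow> real^'n \<Rightarrow> real). \<forall>q\<in>U. \<forall>p.
        f q p = (\<Sum>\<alpha> | sum \<alpha> UNIV \<le> r. a \<alpha> q * (\<Prod>i\<in>UNIV. (p $ i) ^ \<alpha> i)))"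

definition O_group :: "(real^'n^'n) monoid" where
  "O_group = \<lparr>carrier = {A. orthogonal_matrix A}, mult = (**), one = mat 1\<rparr>"

lemma group_O_group: "group (O_group :: (real^'n^'n) monoid)"
proof (rule groupI)
  fix A :: "real^'n^'n"
  assume "A \<in> carrier O_group"
  then show "\<exists>B\<in>carrier O_group. B \<otimes>\<^bsub>O_group\<^esub> A = \<one>\<^bsub>O_group\<^esub>"
    by (intro bexI[of _ "transpose A"])
       (simp_all add: O_group_def orthogonal_matrix_def)
qed (simp_all add: O_group_def orthogonal_matrix_mul orthogonal_matrix_id matrix_mul_assoc)

definition facet_reflections :: "(real^'n) set \<Rightarrow> (real^'n^'n) set" where
  "facet_reflections K =
     {matrix (reflect n) | n. \<exists>x. regular_boundary_point (interior K) x n}"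

lemma facet_reflections_subset: "facet_reflections K \<subseteq> carrier O_group"
proof -
  have "orthogonal_matrix (matrix (reflect n))" if "norm n = 1" for n :: "real^'n"
  proof -
    have lin: "linear (reflect n)"
      by (rule linearI) (simp_all add: reflect_def algebra_simps)
    have "reflect n v \<bullet> reflect n w = v \<bullet> w" for v w
      using that unfolding reflect_def
      by (simp add: norm_eq_1 inner_commute algebra_simps)
    with lin have "orthogonal_transformation (reflect n)"
      by (simp add: orthogonal_transformation_def)
    then show ?thesis by (simp add: orthogonal_transformation_matrix)
  qed
  then show ?thesis
    by (auto simp: facet_reflections_def regular_boundary_point_def O_group_def)
qed

definition billiard_group :: "(real^'n) set \<Rightarrow> (real^'n^'n) set" where
  "billiard_group K =
     (top_of_set (carrier O_group)) closure_of (generate O_group (facet_reflections K))"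

end

theory Submission
  imports Defs
begin

text \<open>A first integral is determined along a line by its values at finitely many points of a parallel line,
  through interpolation in the momentum; this makes it a polynomial \<open>F\<close> in position and momentum without
  any regularity assumption. By the identity theorem \<open>F\<close> is invariant under the affine reflections in all
  facet hyperplanes (acting on positions and momenta). Such reflections fold every position into the closure
  of \<open>int K\<close> while preserving the norm of the momentum, so \<open>F\<close> is bounded in the position, and a bounded
  polynomial is constant.\<close>

subsection \<open>Polynomial functions\<close>

text \<open>The coefficients may be arbitrary functions of the position, so nothing can be
  differentiated or continued at the start. Uniformity replaces regularity: one degree bound serves
  all lines, and polynomiality in each coordinate separately, with a common degree bound, gives
  joint polynomiality. A bounce constrains \<open>F\<close> only at positions on a small piece of
  hyperplane and for outgoing momenta, which is not an open set of pairs. Once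
  \<open>F (y + t p, p) = F (y, p)\<close> holds everywhere, sliding along the momentum turns the
  bounce law into an identity on an open set of pairs. The reflections also move the momentum, so
  the bound on \<open>F\<close> has to be uniform over a sphere of momenta. The generated group need
  not be discrete, so it is not evident that repeated folding stops; a minimizer of the distance on
  a compact level set of \<open>F\<close> takes its place.\<close>

lemma real_polynomial_function_comp:
  assumes "real_polynomial_function G" "polynomial_function h"
  shows "real_polynomial_function (\<lambda>x. G (h x))"
  using real_polynomial_function_compose[OF assms(2,1)] by (simp add: o_def)

lemma real_polynomial_function_on_line:
  assumes "real_polynomial_function G"
  shows "\<exists>P. \<forall>t. G (x + t *\<^sub>R v) = poly P t"
  using assms
proof induction
  case (linear f)
  interpret bounded_linear f by fact
  show ?case by (rule exI[of _ "[:f x, f v:]"]) (simp add: add scaleR)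
next
  case (const c)
  show ?case by (rule exI[of _ "[:c:]"]) simp
next
  case (add f g)
  then obtain P Q where "\<forall>t. f (x + t *\<^sub>R v) = poly P t" "\<forall>t. g (x + t *\<^sub>R v) = poly Q t" by blast
  then show ?case by (intro exI[of _ "P + Q"]) simp
next
  case (mult f g)
  then obtain P Q where "\<forall>t. f (x + t *\<^sub>R v) = poly P t" "\<forall>t. g (x + t *\<^sub>R v) = poly Q t" by blast
  then show ?case by (intro exI[of _ "P * Q"]) simp
qed

text \<open>On the line from \<open>w\<close> to \<open>y\<close> the difference is a polynomial in
  one variable that vanishes for all small parameters, hence identically; parameter 1 is
  \<open>y\<close>.\<close>

lemma real_polynomial_function_eqI_open:
  fixes F G :: "'a::real_normed_vector \<Rightarrow> real"
  assumes F: "real_polynomial_function F" and G: "real_polynomial_function G"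
    and "open W" "w \<in> W" and eq: "\<And>x. x \<in> W \<Longrightarrow> F x = G x"
  shows "F y = G y"
proof -
  obtain P where P: "F (w + t *\<^sub>R (y - w)) - G (w + t *\<^sub>R (y - w)) = poly P t" for t
    using real_polynomial_function_on_line[OF real_polynomial_function_diff[OF F G], of w "y - w"] by blast
  obtain e where "e > 0" and e: "ball w e \<subseteq> W"
    using \<open>open W\<close> \<open>w \<in> W\<close> open_contains_ball by blast
  \<comment> \<open>The \<open>+ 1\<close> keeps the quotient meaningful when
    \<open>y = w\<close>.\<close>
  have "poly P t = 0" if "t \<in> {0<..<e / (norm (y - w) + 1)}" for t
  proof -
    have "t * norm (y - w) \<le> t * (norm (y - w) + 1)" using that by simp
    also have "\<dots> < e" using that by (simp add: pos_less_divide_eq add_nonneg_pos)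
    finally have "w + t *\<^sub>R (y - w) \<in> ball w e" using that by (simp add: dist_norm)
    then show ?thesis using e eq P[of t] by fastforce
  qed
  then have "{0<..<e / (norm (y - w) + 1)} \<subseteq> {t. poly P t = 0}" by blast
  moreover have "infinite {0<..<e / (norm (y - w) + 1)}"
    using \<open>e > 0\<close> by (intro infinite_Ioo divide_pos_pos) (auto intro: add_nonneg_pos)
  ultimately have "P = 0" using poly_roots_finite finite_subset by blast
  then show ?thesis using P[of 1] by simp
qed

lemma bounded_poly_constant:
  fixes P :: "real poly"
  assumes "\<And>t. \<bar>poly P t\<bar> \<le> M"
  shows "poly P t = poly P s"
proof (cases "degree P = 0")
  case True
  then obtain a where "P = [:a:]" by (rule degree_eq_zeroE)
  then show ?thesis by simp
next
  case False
  then have "filterlim (poly P) at_infinity at_infinity" by (simp add: filterlim_poly_at_infinity)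
  then have "filterlim (\<lambda>t. norm (poly P t)) at_top at_infinity"
    by (rule filterlim_at_infinity_imp_norm_at_top)
  then have "eventually (\<lambda>t. M + 1 \<le> norm (poly P t)) at_infinity"
    by (simp add: filterlim_at_top)
  then obtain t where "M + 1 \<le> \<bar>poly P t\<bar>" using eventually_happens'[OF trivial_limit_at_infinity] by force
  then show ?thesis using assms[of t] by linarith
qed

text \<open>Both sides have degree below \<open>card T\<close> and agree on \<open>T\<close>. What
  matters later is the shape: the weights depend on \<open>t\<close> and the nodes only, not on
  \<open>P\<close>.\<close>

lemma lagrange_interpolation:
  fixes P :: "'a::field poly"
  assumes T: "finite T" and deg: "degree P < card T"
  shows "poly P t = (\<Sum>\<tau>\<in>T. poly P \<tau> * (\<Prod>\<sigma>\<in>T - {\<tau>}. (t - \<sigma>) / (\<tau> - \<sigma>)))"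
proof -
  define Q where "Q = (\<Sum>\<tau>\<in>T. smult (poly P \<tau>) (\<Prod>\<sigma>\<in>T - {\<tau>}. [:- \<sigma> / (\<tau> - \<sigma>), 1 / (\<tau> - \<sigma>):]))"
  have Q: "poly Q t = (\<Sum>\<tau>\<in>T. poly P \<tau> * (\<Prod>\<sigma>\<in>T - {\<tau>}. (t - \<sigma>) / (\<tau> - \<sigma>)))" for t
    by (simp add: Q_def poly_sum poly_prod diff_divide_distrib)
  have "degree Q \<le> card T - 1" unfolding Q_def
  proof (rule degree_sum_le[OF T])
    fix \<tau> assume "\<tau> \<in> T"
    have "degree (\<Prod>\<sigma>\<in>T - {\<tau>}. [:- \<sigma> / (\<tau> - \<sigma>), 1 / (\<tau> - \<sigma>):]) \<le> (\<Sum>\<sigma>\<in>T - {\<tau>}. 1)"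
      by (rule order_trans[OF degree_prod_sum_le]) (use T in \<open>simp_all add: sum_mono del: sum_constant\<close>)
    also have "\<dots> = card T - 1" using \<open>\<tau> \<in> T\<close> T by simp
    finally show "degree (smult (poly P \<tau>) (\<Prod>\<sigma>\<in>T - {\<tau>}. [:- \<sigma> / (\<tau> - \<sigma>), 1 / (\<tau> - \<sigma>):])) \<le> card T - 1"
      using degree_smult_le order_trans by blast
  qed
  moreover have "poly Q \<rho> = poly P \<rho>" if "\<rho> \<in> T" for \<rho>
  proof -
    have "(\<Prod>\<sigma>\<in>T - {\<tau>}. (\<rho> - \<sigma>) / (\<tau> - \<sigma>)) = (if \<tau> = \<rho> then 1 else 0)" if "\<tau> \<in> T" for \<tau>
      using T \<open>\<rho> \<in> T\<close> that by (auto intro!: prod.neutral simp: prod_zero_iff)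
    then have "poly Q \<rho> = (\<Sum>\<tau>\<in>T. if \<tau> = \<rho> then poly P \<tau> else 0)"
      unfolding Q by (intro sum.cong) auto
    then show ?thesis using T that by simp
  qed
  ultimately have "P = Q" using deg by (intro poly_eqI_degree[of T]) auto
  then show ?thesis using Q by metis
qed

text \<open>Coordinates are released one at a time. Interpolation in the newly released coordinate
  \<open>b\<close> expresses \<open>g x\<close> by values at points whose
  \<open>b\<close>-coordinate is a node, and there the induction hypothesis applies.\<close>

lemma separately_polynomial:
  fixes g :: "'a::euclidean_space \<Rightarrow> real" and I :: "'a \<Rightarrow> real set"
  defines "S \<equiv> {x. \<forall>b\<in>Basis. x \<bullet> b \<in> I b}"
  assumes inf: "\<And>b. b \<in> Basis \<Longrightarrow> infinite (I b)"
    and sep: "\<And>b x. b \<in> Basis \<Longrightarrow> x \<in> S \<Longrightarrow>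
      \<exists>P. degree P \<le> m \<and> (\<forall>t\<in>I b. g (x + (t - x \<bullet> b) *\<^sub>R b) = poly P t)"
  shows "\<exists>G. real_polynomial_function G \<and> (\<forall>x\<in>S. g x = G x)"
proof -
  \<comment> \<open>\<open>B\<close> is the set of released coordinates; the others are frozen at
    those of \<open>c\<close>. The base point must vary in the induction, since each node replaces
    it.\<close>
  have "\<exists>G. real_polynomial_function G \<and> (\<forall>x\<in>S. (\<forall>b\<in>Basis - B. x \<bullet> b = c \<bullet> b) \<longrightarrow> g x = G x)"
    if "finite B" "B \<subseteq> Basis" "c \<in> S" for B c
    using that
  proof (induction B arbitrary: c)
    case empty
    have "g x = g c" if "\<forall>b\<in>Basis - {}. x \<bullet> b = c \<bullet> b" for x
      using that euclidean_eqI[of x c] by simp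
    then show ?case using real_polynomial_function.intros(2) by blast
  next
    case (insert b B)
    have b: "b \<in> Basis" using insert by auto
    \<comment> \<open>The degree bound \<open>m\<close> is independent of \<open>x\<close>, so the
      same \<open>m + 1\<close> nodes serve every line in direction \<open>b\<close>.\<close>
    obtain T where T: "T \<subseteq> I b" "finite T" "card T = Suc m"
      using infinite_arbitrarily_large[OF inf[OF b]] by blast
    define pr where "pr = (\<lambda>\<tau> x :: 'a. x + (\<tau> - x \<bullet> b) *\<^sub>R b)"
    have prb: "pr \<tau> x \<bullet> b' = (if b' = b then \<tau> else x \<bullet> b')" if "b' \<in> Basis" for \<tau> x b'
      using that b by (auto simp: pr_def inner_add_left inner_diff_left inner_Basis)
    have prS: "pr \<tau> x \<in> S" if "x \<in> S" "\<tau> \<in> T" for \<tau> x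
      using that T by (auto simp: S_def prb)
    have "\<exists>G. real_polynomial_function G \<and> (\<forall>x\<in>S. (\<forall>b'\<in>Basis - B. x \<bullet> b' = pr \<tau> c \<bullet> b') \<longrightarrow> g x = G x)"
      if "\<tau> \<in> T" for \<tau>
      using insert.IH[OF _ prS[OF _ that]] insert.prems by auto
    then obtain H where H: "\<And>\<tau>. \<tau> \<in> T \<Longrightarrow> real_polynomial_function (H \<tau>)"
      and Hg: "\<And>\<tau> x. \<tau> \<in> T \<Longrightarrow> x \<in> S \<Longrightarrow> (\<forall>b'\<in>Basis - B. x \<bullet> b' = pr \<tau> c \<bullet> b') \<Longrightarrow> g x = H \<tau> x"
      by metis
    define G where "G = (\<lambda>x. \<Sum>\<tau>\<in>T. H \<tau> (pr \<tau> x) * (\<Prod>\<sigma>\<in>T - {\<tau>}. (x \<bullet> b - \<sigma>) / (\<tau> - \<sigma>)))"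
    have lin: "real_polynomial_function (\<lambda>x :: 'a. x \<bullet> b)"
      by (intro real_polynomial_function.intros(1) bounded_linear_inner_left)
    have "polynomial_function (\<lambda>x :: 'a. \<tau> - x \<bullet> b)" for \<tau>
      unfolding real_polynomial_function_eq[symmetric]
      by (intro real_polynomial_function_diff real_polynomial_function.intros(2) lin)
    then have pr: "polynomial_function (pr \<tau>)" for \<tau>
      unfolding pr_def
      by (rule polynomial_function_add[OF polynomial_function_id
            polynomial_function_mult[OF _ polynomial_function_const]])
    have L: "real_polynomial_function (\<lambda>x :: 'a. \<Prod>\<sigma>\<in>T - {\<tau>}. (x \<bullet> b - \<sigma>) / (\<tau> - \<sigma>))" for \<tau>
      by (rule real_polynomial_function_prod)
        (use T lin in \<open>auto intro!: real_polynomial_function_divide real_polynomial_function_diff\<close>)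
    have "real_polynomial_function G"
      unfolding G_def
      by (intro real_polynomial_function_sum real_polynomial_function.intros(4)
          real_polynomial_function_comp[OF H pr] L T(2))
    moreover have "g x = G x" if x: "x \<in> S" "\<forall>b'\<in>Basis - insert b B. x \<bullet> b' = c \<bullet> b'" for x
    proof -
      obtain P where P: "degree P \<le> m" "\<And>t. t \<in> I b \<Longrightarrow> g (pr t x) = poly P t"
        using sep[OF b x(1)] by (auto simp: pr_def)
      have "x \<bullet> b \<in> I b" using x(1) b by (auto simp: S_def)
      then have "g x = poly P (x \<bullet> b)" using P(2)[of "x \<bullet> b"] by (simp add: pr_def)
      also have "\<dots> = (\<Sum>\<tau>\<in>T. poly P \<tau> * (\<Prod>\<sigma>\<in>T - {\<tau>}. (x \<bullet> b - \<sigma>) / (\<tau> - \<sigma>)))"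
        using T P(1) by (intro lagrange_interpolation) auto
      also have "\<dots> = G x" unfolding G_def
      proof (rule sum.cong[OF refl])
        fix \<tau> assume \<tau>: "\<tau> \<in> T"
        have "poly P \<tau> = g (pr \<tau> x)" using P(2) \<tau> T by auto
        also have "\<dots> = H \<tau> (pr \<tau> x)"
          using x b by (intro Hg \<tau> prS) (auto simp: prb)
        finally show "poly P \<tau> * (\<Prod>\<sigma>\<in>T - {\<tau>}. (x \<bullet> b - \<sigma>) / (\<tau> - \<sigma>)) =
            H \<tau> (pr \<tau> x) * (\<Prod>\<sigma>\<in>T - {\<tau>}. (x \<bullet> b - \<sigma>) / (\<tau> - \<sigma>))" by simp
      qed
      finally show ?thesis .
    qed
    ultimately show ?case by blast
  qed
  note * = this[OF finite_Basis subset_refl]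
  show ?thesis
  proof (cases "S = {}")
    case False
    then obtain c where "c \<in> S" by blast
    from *[OF this] show ?thesis by auto
  qed auto
qed

subsection \<open>First integrals of the free motion\<close>

text \<open>The unknown coefficients disappear here: what survives is a degree bound
  \<open>r\<close> common to all positions and all directions.\<close>

lemma polynomial_in_momentum_on_line:
  assumes "polynomial_in_momentum U f"
  obtains r where "\<And>q p v. q \<in> U \<Longrightarrow> \<exists>P. degree P \<le> r \<and> (\<forall>t. f q (p + t *\<^sub>R v) = poly P t)"
proof -
  obtain r a where "\<forall>q\<in>U. \<forall>p. f q p = (\<Sum>\<alpha> | sum \<alpha> UNIV \<le> r. a \<alpha> q * (\<Prod>i\<in>UNIV. (p $ i) ^ \<alpha> i))"
    using assms unfolding polynomial_in_momentum_def by (elim exE)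
  then have f: "f q p = (\<Sum>\<alpha> | sum \<alpha> UNIV \<le> r. a \<alpha> q * (\<Prod>i\<in>UNIV. (p $ i) ^ \<alpha> i))" if "q \<in> U" for q p
    using that by simp
  show thesis
  proof (rule that[of r])
    fix q p v assume "q \<in> U"
    define P where "P = (\<Sum>\<alpha> | sum \<alpha> UNIV \<le> r. smult (a \<alpha> q) (\<Prod>i\<in>UNIV. [:p $ i, v $ i:] ^ \<alpha> i))"
    have "degree P \<le> r" unfolding P_def
    proof (rule degree_sum_le[OF finite_multi_indices])
      fix \<alpha> :: "'a \<Rightarrow> nat" assume "\<alpha> \<in> {\<alpha>. sum \<alpha> UNIV \<le> r}"
      have "degree (\<Prod>i\<in>UNIV. [:p $ i, v $ i:] ^ \<alpha> i) \<le> (\<Sum>i\<in>UNIV. degree ([:p $ i, v $ i:] ^ \<alpha> i))"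
        using degree_prod_sum_le[of UNIV "\<lambda>i. [:p $ i, v $ i:] ^ \<alpha> i"] by (simp add: o_def)
      also have "\<dots> \<le> (\<Sum>i\<in>UNIV. \<alpha> i)"
      proof (rule sum_mono)
        fix i show "degree ([:p $ i, v $ i:] ^ \<alpha> i) \<le> \<alpha> i"
          by (rule order_trans[OF degree_power_le]) simp
      qed
      also have "\<dots> \<le> r" using \<open>\<alpha> \<in> _\<close> by simp
      finally show "degree (smult (a \<alpha> q) (\<Prod>i\<in>UNIV. [:p $ i, v $ i:] ^ \<alpha> i)) \<le> r"
        using degree_smult_le order_trans by blast
    qed
    moreover have "f q (p + t *\<^sub>R v) = poly P t" for t
      by (simp add: f[OF \<open>q \<in> U\<close>] P_def poly_sum poly_prod)
    ultimately show "\<exists>P. degree P \<le> r \<and> (\<forall>t. f q (p + t *\<^sub>R v) = poly P t)" by blast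
  qed
qed

text \<open>From every point of the line \<open>q + s v\<close>, the node \<open>q + \<tau> p + j v\<close> of a parallel line is reached with
  momentum \<open>p + ((j - s) / \<tau>) v\<close>. The values of \<open>f\<close> at such momenta are thus polynomials in \<open>s\<close>, and
  Lagrange interpolation in \<open>j\<close>, evaluated at \<open>j = s\<close>, recovers the value at momentum \<open>p\<close>; the
  denominators do not depend on \<open>s\<close>.\<close>

lemma first_integral_on_line:
  fixes f :: "'a::real_normed_vector \<Rightarrow> 'a \<Rightarrow> real"
  assumes free: "\<And>q p t. closed_segment q (q + t *\<^sub>R p) \<subseteq> U \<Longrightarrow> f (q + t *\<^sub>R p) p = f q p"
    and mom: "\<And>q p v. q \<in> U \<Longrightarrow> \<exists>P. degree P \<le> r \<and> (\<forall>t. f q (p + t *\<^sub>R v) = poly P t)"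
    and U: "ball c (2 * \<epsilon>) \<subseteq> U" and \<epsilon>: "\<epsilon> > 0"
    and J: "infinite J" "\<And>s. s \<in> J \<Longrightarrow> q + s *\<^sub>R v \<in> ball c \<epsilon>"
  shows "\<exists>P. degree P \<le> 2 * r \<and> (\<forall>s\<in>J. f (q + s *\<^sub>R v) p = poly P s)"
proof -
  obtain T where T: "T \<subseteq> J" "finite T" "card T = Suc r"
    using infinite_arbitrarily_large[OF J(1)] by blast
  \<comment> \<open>A travel time during which momentum \<open>p\<close> covers less than
    \<epsilon>; the \<open>+ 1\<close> allows \<open>p = 0\<close>. The nodes then stay in the ball
    of radius \<open>2 * \<epsilon>\<close>.\<close>
  define \<tau> where "\<tau> = \<epsilon> / (norm p + 1)"
  have "\<tau> > 0" using \<epsilon> by (simp add: \<tau>_def add_nonneg_pos)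
  have "norm (\<tau> *\<^sub>R p) = \<epsilon> * (norm p / (norm p + 1))" using \<epsilon> by (simp add: \<tau>_def)
  also have "\<dots> < \<epsilon>" using \<epsilon> by (simp add: pos_divide_less_eq add_nonneg_pos)
  finally have \<tau>: "norm (\<tau> *\<^sub>R p) < \<epsilon>" .
  have node: "q + \<tau> *\<^sub>R p + j *\<^sub>R v \<in> ball c (2 * \<epsilon>)" if "j \<in> J" for j
  proof -
    have "dist c (q + \<tau> *\<^sub>R p + j *\<^sub>R v) \<le> dist c (q + j *\<^sub>R v) + dist (q + j *\<^sub>R v) (q + \<tau> *\<^sub>R p + j *\<^sub>R v)"
      by (rule dist_triangle)
    also have "dist (q + j *\<^sub>R v) (q + \<tau> *\<^sub>R p + j *\<^sub>R v) < \<epsilon>" using \<tau> by (simp add: dist_norm)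
    finally show ?thesis using J(2)[OF that] by simp
  qed
  have "\<exists>R. degree R \<le> r \<and> (\<forall>t. f (q + \<tau> *\<^sub>R p + j *\<^sub>R v) (p + t *\<^sub>R v) = poly R t)" if "j \<in> T" for j
    using mom node that T(1) U by blast
  then obtain R where R: "\<And>j. j \<in> T \<Longrightarrow> degree (R j) \<le> r"
    "\<And>j t. j \<in> T \<Longrightarrow> f (q + \<tau> *\<^sub>R p + j *\<^sub>R v) (p + t *\<^sub>R v) = poly (R j) t" by metis
  define L where "L j = (\<Prod>i\<in>T - {j}. [:- i / (j - i), 1 / (j - i):])" for j
  \<comment> \<open>The inner polynomial is \<open>s \<mapsto> (j - s) / \<tau>\<close>, the
    multiple of \<open>v\<close> added to the momentum aimed at node \<open>j\<close>. Momentum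
    dependence and interpolation weight each contribute degree at most \<open>r\<close>, whence
    \<open>2 * r\<close>.\<close>
  define P where "P = (\<Sum>j\<in>T. pcompose (R j) [:j / \<tau>, - 1 / \<tau>:] * L j)"
  have "degree (pcompose (R j) [:j / \<tau>, - 1 / \<tau>:] * L j) \<le> 2 * r" if "j \<in> T" for j
  proof -
    have "degree (L j) \<le> (\<Sum>i\<in>T - {j}. 1)" unfolding L_def
      by (rule order_trans[OF degree_prod_sum_le]) (use T in \<open>simp_all add: sum_mono del: sum_constant\<close>)
    also have "\<dots> = r" using that T by simp
    finally have "degree (L j) \<le> r" .
    moreover have "degree (pcompose (R j) [:j / \<tau>, - 1 / \<tau>:]) \<le> r"
      using R(1)[OF that] by (simp add: degree_pcompose)
    ultimately show ?thesis
      using degree_mult_le[of "pcompose (R j) [:j / \<tau>, - 1 / \<tau>:]" "L j"] by linarith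
  qed
  then have "degree P \<le> 2 * r" unfolding P_def by (intro degree_sum_le T)
  moreover have "f (q + s *\<^sub>R v) p = poly P s" if s: "s \<in> J" for s
  proof -
    have "q + s *\<^sub>R v \<in> U" using J(2)[OF s] U \<epsilon> by (auto simp: subset_iff)
    then obtain Q where Q: "degree Q \<le> r" "\<And>t. f (q + s *\<^sub>R v) (p + t *\<^sub>R v) = poly Q t"
      using mom by metis
    \<comment> \<open>At fixed \<open>s\<close> this is a polynomial in the target \<open>j\<close>;
      the target \<open>j = s\<close> corresponds to momentum \<open>p\<close> itself.\<close>
    define \<psi> where "\<psi> = pcompose Q [:- s / \<tau>, 1 / \<tau>:]"
    have \<psi>: "poly \<psi> j = f (q + s *\<^sub>R v) (p + ((j - s) / \<tau>) *\<^sub>R v)" for j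
      by (simp add: \<psi>_def poly_pcompose Q(2) diff_divide_distrib)
    have "degree \<psi> < card T" using Q(1) T(3) \<open>\<tau> > 0\<close> by (simp add: \<psi>_def degree_pcompose)
    then have "poly \<psi> s = (\<Sum>j\<in>T. poly \<psi> j * (\<Prod>i\<in>T - {j}. (s - i) / (j - i)))"
      by (intro lagrange_interpolation T)
    also have "\<dots> = poly P s" unfolding P_def poly_sum
    proof (rule sum.cong[OF refl])
      fix j assume j: "j \<in> T"
      have eq: "q + s *\<^sub>R v + \<tau> *\<^sub>R (p + ((j - s) / \<tau>) *\<^sub>R v) = q + \<tau> *\<^sub>R p + j *\<^sub>R v"
        using \<open>\<tau> > 0\<close> by (simp add: scaleR_right_distrib scaleR_left_diff_distrib)
      have "closed_segment (q + s *\<^sub>R v) (q + \<tau> *\<^sub>R p + j *\<^sub>R v) \<subseteq> ball c (2 * \<epsilon>)"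
        using J(2)[OF s] node[of j] j T(1) \<epsilon> by (intro closed_segment_subset) auto
      then have "f (q + \<tau> *\<^sub>R p + j *\<^sub>R v) (p + ((j - s) / \<tau>) *\<^sub>R v) = poly \<psi> j"
        using free[of "q + s *\<^sub>R v" \<tau> "p + ((j - s) / \<tau>) *\<^sub>R v"] U unfolding eq \<psi> by blast
      then show "poly \<psi> j * (\<Prod>i\<in>T - {j}. (s - i) / (j - i)) =
          poly (pcompose (R j) [:j / \<tau>, - 1 / \<tau>:] * L j) s"
        using R(2)[OF j] by (simp add: L_def poly_prod poly_pcompose diff_divide_distrib)
    qed
    finally show ?thesis using \<psi>[of s] by simp
  qed
  ultimately show ?thesis by blast
qed

text \<open>\<open>separately_polynomial\<close> is applied in the product space, with positions in
  a cube and unrestricted momenta. Position directions are handled by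
  \<open>first_integral_on_line\<close>, momentum directions by \<open>mom\<close>.\<close>

lemma first_integral_locally_polynomial:
  fixes f :: "'a::euclidean_space \<Rightarrow> 'a \<Rightarrow> real"
  assumes free: "\<And>q p t. closed_segment q (q + t *\<^sub>R p) \<subseteq> U \<Longrightarrow> f (q + t *\<^sub>R p) p = f q p"
    and mom: "\<And>q p v. q \<in> U \<Longrightarrow> \<exists>P. degree P \<le> r \<and> (\<forall>t. f q (p + t *\<^sub>R v) = poly P t)"
    and "open U" "c \<in> U"
  shows "\<exists>e F. e > 0 \<and> real_polynomial_function F \<and> (\<forall>q\<in>ball c e. q \<in> U \<and> (\<forall>p. f q p = F (q, p)))"
proof -
  obtain \<epsilon>' where "\<epsilon>' > 0" "ball c \<epsilon>' \<subseteq> U" using \<open>open U\<close> \<open>c \<in> U\<close> open_contains_ball by blast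
  then obtain \<epsilon> where \<epsilon>: "\<epsilon> > 0" "ball c (2 * \<epsilon>) \<subseteq> U"
    by (metis field_sum_of_halves half_gt_zero mult_2)
  \<comment> \<open>By the l1 bound on the norm, the cube of half-side \<delta> fits into the ball
    of radius \<epsilon>.\<close>
  define \<delta> where "\<delta> = \<epsilon> / DIM('a)"
  have "\<delta> > 0" using \<epsilon> by (simp add: \<delta>_def)
  define W where "W = {q. \<forall>b\<in>Basis. q \<bullet> b \<in> {c \<bullet> b - \<delta><..<c \<bullet> b + \<delta>}}"
  have W: "W \<subseteq> ball c \<epsilon>"
  proof
    fix q assume "q \<in> W"
    have "norm (c - q) \<le> (\<Sum>b\<in>Basis. \<bar>(c - q) \<bullet> b\<bar>)" by (rule norm_le_l1)
    also have "\<dots> < (\<Sum>b\<in>(Basis :: 'a set). \<delta>)"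
      using \<open>q \<in> W\<close> by (intro sum_strict_mono) (auto simp: W_def inner_diff_left abs_less_iff)
    also have "\<dots> = \<epsilon>" by (simp add: \<delta>_def)
    finally show "q \<in> ball c \<epsilon>" by (simp add: dist_norm)
  qed
  \<comment> \<open>Basis vectors of the product are \<open>(u, 0)\<close> and
    \<open>(0, u)\<close>; a zero second component marks a position direction.\<close>
  define I where "I = (\<lambda>z :: 'a \<times> 'a. if snd z = 0 then {c \<bullet> fst z - \<delta><..<c \<bullet> fst z + \<delta>} else UNIV)"
  have S: "x \<in> {x. \<forall>b\<in>Basis. x \<bullet> b \<in> I b} \<longleftrightarrow> fst x \<in> W" for x
    by (cases x) (auto simp: Basis_prod_def I_def W_def ball_Un)
  have "\<exists>G. real_polynomial_function G \<and> (\<forall>x\<in>{x. \<forall>b\<in>Basis. x \<bullet> b \<in> I b}. case_prod f x = G x)"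
  proof (rule separately_polynomial[where m = "2 * r"])
    fix b :: "'a \<times> 'a" assume "b \<in> Basis"
    then show "infinite (I b)"
      using \<open>\<delta> > 0\<close> infinite_UNIV_char_0[where 'a = real] by (auto simp: I_def infinite_Ioo)
  next
    fix b x :: "'a \<times> 'a"
    assume b: "b \<in> Basis" and "x \<in> {x. \<forall>b\<in>Basis. x \<bullet> b \<in> I b}"
    then have "fst x \<in> W" using S by blast
    obtain q p where x: "x = (q, p)" by force
    have q: "q \<in> W" using \<open>fst x \<in> W\<close> x by simp
    consider u where "u \<in> Basis" "b = (u, 0)" | u where "u \<in> Basis" "b = (0, u)"
      using b by (auto simp: Basis_prod_def)
    then show "\<exists>P. degree P \<le> 2 * r \<and> (\<forall>t\<in>I b. case_prod f (x + (t - x \<bullet> b) *\<^sub>R b) = poly P t)"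
    proof cases
      case 1
      have Ib: "I b = {c \<bullet> u - \<delta><..<c \<bullet> u + \<delta>}" using 1 by (simp add: I_def)
      \<comment> \<open>Removing the \<open>u\<close>-coordinate from the base point makes the line
        parameter equal to that coordinate.\<close>
      have eq: "(q - (q \<bullet> u) *\<^sub>R u) + t *\<^sub>R u = q + (t - q \<bullet> u) *\<^sub>R u" for t
        by (simp add: algebra_simps)
      have "q + (t - q \<bullet> u) *\<^sub>R u \<in> W" if "t \<in> I b" for t
        using that q 1(1) unfolding Ib W_def
        by (auto simp: inner_add_left inner_Basis)
      then have "\<exists>P. degree P \<le> 2 * r \<and>
          (\<forall>t\<in>I b. f ((q - (q \<bullet> u) *\<^sub>R u) + t *\<^sub>R u) p = poly P t)"
        using W \<open>\<delta> > 0\<close>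
        by (intro first_integral_on_line[OF free mom \<epsilon>(2,1)]) (auto simp: Ib infinite_Ioo eq subset_iff)
      then show ?thesis unfolding eq using 1 x by simp
    next
      case 2
      have "q \<in> U" using q W \<epsilon> by (force simp: subset_iff)
      from mom[OF this, of "p - (p \<bullet> u) *\<^sub>R u" u] obtain P where P: "degree P \<le> r"
        "\<And>t. f q (p - (p \<bullet> u) *\<^sub>R u + t *\<^sub>R u) = poly P t" by blast
      have "f q (p + (t - p \<bullet> u) *\<^sub>R u) = poly P t" for t
        using P(2)[of t] by (simp add: algebra_simps)
      then show ?thesis using 2 x P(1) by (intro exI[of _ P]) simp
    qed
  qed
  then obtain G where G: "real_polynomial_function G" "\<And>q p. q \<in> W \<Longrightarrow> f q p = G (q, p)"
    using S by force
  have \<delta>W: "ball c \<delta> \<subseteq> W"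
  proof
    fix q assume q: "q \<in> ball c \<delta>"
    have "\<bar>(q - c) \<bullet> b\<bar> < \<delta>" if "b \<in> Basis" for b
      using Basis_le_norm[OF that, of "q - c"] q by (simp add: dist_norm norm_minus_commute)
    then show "q \<in> W" by (force simp: W_def inner_diff_left abs_less_iff)
  qed
  moreover have "ball c \<delta> \<subseteq> U"
    using \<delta>W W \<epsilon> subset_ball[of \<epsilon> "2 * \<epsilon>" c] by auto
  ultimately show ?thesis using G \<open>\<delta> > 0\<close> by blast
qed

text \<open>The local polynomials at two nearby centres agree on an open set of pairs, hence
  everywhere; so the polynomial is a locally constant function of the centre, and \<open>U\<close>
  is connected.\<close>

lemma first_integral_polynomial:
  fixes f :: "'a::euclidean_space \<Rightarrow> 'a \<Rightarrow> real"
  assumes free: "\<And>q p t. closed_segment q (q + t *\<^sub>R p) \<subseteq> U \<Longrightarrow> f (q + t *\<^sub>R p) p = f q p"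
    and mom: "\<And>q p v. q \<in> U \<Longrightarrow> \<exists>P. degree P \<le> r \<and> (\<forall>t. f q (p + t *\<^sub>R v) = poly P t)"
    and "open U" "connected U"
  shows "\<exists>F. real_polynomial_function F \<and> (\<forall>q\<in>U. \<forall>p. f q p = F (q, p))"
proof (cases "U = {}")
  case True
  then show ?thesis using real_polynomial_function.intros(2) by blast
next
  case False
  then obtain q0 where "q0 \<in> U" by blast
  obtain e F where e: "\<And>c. c \<in> U \<Longrightarrow> e c > 0" and F: "\<And>c. c \<in> U \<Longrightarrow> real_polynomial_function (F c)"
    and eq: "\<And>c q p. c \<in> U \<Longrightarrow> q \<in> ball c (e c) \<Longrightarrow> q \<in> U \<and> f q p = F c (q, p)"
    using first_integral_locally_polynomial[OF free mom \<open>open U\<close>] by metis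
  have "F q0 = F q" if "q \<in> U" for q
  proof (rule connected_equivalence_relation[OF \<open>connected U\<close> \<open>q0 \<in> U\<close> that])
    fix a assume a: "a \<in> U"
    have "F a = F x" if x: "x \<in> ball a (e a)" for x
    proof
      fix z
      have xU: "x \<in> U" using eq[OF a x] by blast
      show "F a z = F x z"
      proof (rule real_polynomial_function_eqI_open[OF F[OF a] F[OF xU]])
        show "open ((ball a (e a) \<inter> ball x (e x)) \<times> (UNIV :: 'a set))"
          by (intro open_Times open_Int) auto
        show "(x, 0) \<in> (ball a (e a) \<inter> ball x (e x)) \<times> (UNIV :: 'a set)"
          using x e[OF xU] by simp
        fix y assume "y \<in> (ball a (e a) \<inter> ball x (e x)) \<times> (UNIV :: 'a set)"
        then show "F a y = F x y" using eq[OF a] eq[OF xU] by (metis IntE SigmaE)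
      qed
    qed
    moreover have "openin (top_of_set U) (ball a (e a))"
      using eq[OF a] by (intro openin_open_eq[THEN iffD2]) (use \<open>open U\<close> in auto)
    ultimately show "\<exists>T. openin (top_of_set U) T \<and> a \<in> T \<and> (\<forall>x\<in>T. F a = F x)"
      using e[OF a] by (intro exI[of _ "ball a (e a)"]) auto
  qed auto
  then have "f q p = F q0 (q, p)" if "q \<in> U" for q p
    using eq[OF that, of q p] e[OF that] that by simp
  then show ?thesis using F[OF \<open>q0 \<in> U\<close>] by blast
qed

subsection \<open>Facet hyperplanes\<close>

text \<open>General position by measure: finitely many hyperplanes are negligible, a nonempty open
  set is not.\<close>

lemma exists_off_hyperplanes:
  fixes W :: "'a::euclidean_space set"
  assumes "finite L" and "\<forall>(a, b)\<in>L. a \<noteq> 0" and "open W" "W \<noteq> {}"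
  shows "\<exists>w\<in>W. \<forall>(a, b)\<in>L. a \<bullet> w \<noteq> b"
proof (rule ccontr)
  assume "\<not> ?thesis"
  then have "W \<subseteq> (\<Union>(a, b)\<in>L. {w. a \<bullet> w = b})" by fastforce
  moreover have "negligible (\<Union>(a, b)\<in>L. {w. a \<bullet> w = b})"
  proof (rule negligible_Union)
    fix T assume "T \<in> (\<lambda>(a, b). {w. a \<bullet> w = b}) ` L"
    then obtain a b where "(a, b) \<in> L" "T = {w. a \<bullet> w = b}" by auto
    moreover from this have "a \<noteq> 0" using assms(2) by auto
    ultimately show "negligible T" by (simp add: negligible_hyperplane)
  qed (use assms(1) in simp)
  ultimately show False
    using open_not_negligible[OF assms(3,4)] negligible_subset by blast
qed

text \<open>Collecting the inequalities of all pieces forgets how the pieces are combined. That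
  their truth values decide membership is enough for the local analysis, and it copes with
  nonconvexity.\<close>

lemma finite_union_polyhedra_inequalities:
  fixes K :: "'a::euclidean_space set"
  assumes "finite \<C>" "\<And>C. C \<in> \<C> \<Longrightarrow> polyhedron C" "K = \<Union>\<C>"
  obtains L where "finite L" "\<And>a b. (a, b) \<in> L \<Longrightarrow> a \<noteq> 0"
    "\<And>x y. (\<And>a b. (a, b) \<in> L \<Longrightarrow> a \<bullet> x \<le> b \<longleftrightarrow> a \<bullet> y \<le> b) \<Longrightarrow> x \<in> K \<longleftrightarrow> y \<in> K"
proof -
  have "\<exists>L. finite L \<and> (\<forall>(a, b)\<in>L. a \<noteq> 0) \<and> C = {x. \<forall>(a, b)\<in>L. a \<bullet> x \<le> b}" if "C \<in> \<C>" for C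
  proof -
    obtain F where F: "finite F" "C = \<Inter>F" "\<forall>h\<in>F. \<exists>a b. a \<noteq> 0 \<and> h = {x. a \<bullet> x \<le> b}"
      using assms(2)[OF \<open>C \<in> \<C>\<close>] unfolding polyhedron_def by (elim exE conjE)
    from F(3) obtain a b where ab: "\<And>h. h \<in> F \<Longrightarrow> a h \<noteq> 0 \<and> h = {x. a h \<bullet> x \<le> b h}" by metis
    have "C = {x. \<forall>h\<in>F. a h \<bullet> x \<le> b h}" unfolding F(2) using ab by blast
    then show ?thesis using F(1) ab by (intro exI[of _ "(\<lambda>h. (a h, b h)) ` F"]) auto
  qed
  then have "\<exists>L. \<forall>C\<in>\<C>. finite (L C) \<and> (\<forall>(a, b)\<in>L C. a \<noteq> 0) \<and> C = {x. \<forall>(a, b)\<in>L C. a \<bullet> x \<le> b}"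
    by (intro bchoice) blast
  then obtain L where L': "\<forall>C\<in>\<C>. finite (L C) \<and> (\<forall>(a, b)\<in>L C. a \<noteq> 0) \<and> C = {x. \<forall>(a, b)\<in>L C. a \<bullet> x \<le> b}"
    by (elim exE)
  then have L: "finite (L C)" "(a, b) \<in> L C \<Longrightarrow> a \<noteq> 0" "C = {x. \<forall>(a, b)\<in>L C. a \<bullet> x \<le> b}"
    if "C \<in> \<C>" for C a b using that by blast+
  show thesis
  proof (rule that[of "\<Union>C\<in>\<C>. L C"])
    show "finite (\<Union>C\<in>\<C>. L C)" using assms(1) L(1) by blast
    show "a \<noteq> 0" if "(a, b) \<in> (\<Union>C\<in>\<C>. L C)" for a b using that L(2) by blast
    fix x y assume "\<And>a b. (a, b) \<in> (\<Union>C\<in>\<C>. L C) \<Longrightarrow> a \<bullet> x \<le> b \<longleftrightarrow> a \<bullet> y \<le> b"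
    then have "x \<in> C \<longleftrightarrow> y \<in> C" if "C \<in> \<C>" for C
      using that by (subst (1 2) L(3)[OF that]) fastforce
    then show "x \<in> K \<longleftrightarrow> y \<in> K" unfolding assms(3) by blast
  qed
qed

text \<open>Near \<open>y\<close> only hyperplanes through \<open>y\<close> can change the truth
  value of their inequality.\<close>

lemma inequalities_locally_constant:
  fixes L :: "('a::real_inner \<times> real) set"
  assumes "finite L"
  obtains e where "e > 0"
    "\<And>a b x. (a, b) \<in> L \<Longrightarrow> a \<bullet> y \<noteq> b \<Longrightarrow> x \<in> ball y e \<Longrightarrow> a \<bullet> x \<le> b \<longleftrightarrow> a \<bullet> y \<le> b"
proof -
  have "\<forall>\<^sub>F x in nhds y. a \<bullet> y \<noteq> b \<longrightarrow> (a \<bullet> x \<le> b \<longleftrightarrow> a \<bullet> y \<le> b)" for a b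
  proof (cases "a \<bullet> y" b rule: linorder_cases)
    case less
    have "open {x. a \<bullet> x < b}" by (rule open_halfspace_lt)
    then have "\<forall>\<^sub>F x in nhds y. x \<in> {x. a \<bullet> x < b}" using less by (intro eventually_nhds_in_open) auto
    then show ?thesis using less by (auto elim!: eventually_mono)
  next
    case greater
    have "open {x. a \<bullet> x > b}" by (rule open_halfspace_gt)
    then have "\<forall>\<^sub>F x in nhds y. x \<in> {x. a \<bullet> x > b}" using greater by (intro eventually_nhds_in_open) auto
    then show ?thesis using greater by (auto elim!: eventually_mono)
  qed auto
  then have "\<forall>\<^sub>F x in nhds y. \<forall>z\<in>L. fst z \<bullet> y \<noteq> snd z \<longrightarrow> (fst z \<bullet> x \<le> snd z \<longleftrightarrow> fst z \<bullet> y \<le> snd z)"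
    using assms by (intro eventually_ball_finite) auto
  then obtain e where "e > 0"
    "\<And>x. dist x y < e \<Longrightarrow> \<forall>z\<in>L. fst z \<bullet> y \<noteq> snd z \<longrightarrow> (fst z \<bullet> x \<le> snd z \<longleftrightarrow> fst z \<bullet> y \<le> snd z)"
    unfolding eventually_nhds_metric by blast
  then show thesis by (intro that[of e]) (force simp: dist_commute)+
qed

lemma regular_boundary_point_uminus:
  "regular_boundary_point U x (- n) \<longleftrightarrow> regular_boundary_point U x n"
  unfolding regular_boundary_point_def by auto

text \<open>The assumptions leave the hyperplane itself open; passing to the interior settles it,
  because an open subset of a closed half-space lies in the open half-space.\<close>

lemma regular_boundary_pointI:
  fixes K :: "'a::euclidean_space set"
  assumes "y \<in> frontier (interior K)" "e > 0" "a \<noteq> 0" "a \<bullet> y = b"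
    and inside: "\<And>x. x \<in> ball y e \<Longrightarrow> a \<bullet> x < b \<Longrightarrow> x \<in> K"
    and outside: "\<And>x. x \<in> ball y e \<Longrightarrow> a \<bullet> x > b \<Longrightarrow> x \<notin> K"
  shows "regular_boundary_point (interior K) y (a /\<^sub>R norm a)"
proof -
  have "interior K \<inter> ball y e \<subseteq> {x. a \<bullet> x \<le> b}" using outside interior_subset by force
  then have "interior K \<inter> ball y e \<subseteq> interior {x. a \<bullet> x \<le> b}"
    by (intro interior_maximal) auto
  then have "interior K \<inter> ball y e \<subseteq> {x. a \<bullet> x < b}" using \<open>a \<noteq> 0\<close> by simp
  moreover have "ball y e \<inter> {x. a \<bullet> x < b} \<subseteq> interior K"
    using inside by (intro interior_maximal open_Int open_halfspace_lt) auto
  ultimately have "interior K \<inter> ball y e = {x \<in> ball y e. a \<bullet> x < b}" by blast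
  also have "\<dots> = {x \<in> ball y e. (a /\<^sub>R norm a) \<bullet> (x - y) < 0}"
    using \<open>a \<noteq> 0\<close> \<open>a \<bullet> y = b\<close> by (auto simp: inner_diff_right mult_less_0_iff)
  finally show ?thesis unfolding regular_boundary_point_def using assms by auto
qed

text \<open>Each side of the hyperplane is locally all in \<open>K\<close> or all outside. Since
  \<open>y\<close> is a limit of interior points but not interior, both kinds of point occur off the
  hyperplane, hence on opposite sides.\<close>

lemma regular_boundary_point_on_single_hyperplane:
  fixes K :: "'a::euclidean_space set"
  assumes "closed K" and y: "y \<in> frontier (interior K)" and "e > 0" "a \<noteq> 0" "a \<bullet> y = b"
    and same: "\<And>u v. u \<in> ball y e \<Longrightarrow> v \<in> ball y e \<Longrightarrow> 
      a \<bullet> u < b \<and> a \<bullet> v < b \<or> a \<bullet> u > b \<and> a \<bullet> v > b \<Longrightarrow> u \<in> K \<longleftrightarrow> v \<in> K"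
  shows "regular_boundary_point (interior K) y (a /\<^sub>R norm a)"
proof -
  have off: "\<exists>w\<in>W. a \<bullet> w \<noteq> b" if "open W" "W \<noteq> {}" for W
    using exists_off_hyperplanes[of "{(a, b)}" W] that \<open>a \<noteq> 0\<close> by auto
  have "y \<notin> interior K" "y \<in> closure (interior K)"
    using y by (auto simp: frontier_def)
  have "\<not> ball y e \<subseteq> K"
    using \<open>e > 0\<close> \<open>y \<notin> interior K\<close> by (meson centre_in_ball interior_maximal open_ball subsetD)
  then obtain v where v: "v \<in> ball y e" "v \<notin> K" "a \<bullet> v \<noteq> b"
    using off[of "ball y e - K"] \<open>closed K\<close> by (metis DiffD1 DiffD2 Diff_eq_empty_iff open_Diff open_ball)
  have "interior K \<inter> ball y e \<noteq> {}"
    using \<open>y \<in> closure (interior K)\<close> \<open>e > 0\<close> open_Int_closure_eq_empty[of "ball y e" "interior K"]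
    by (metis Int_commute centre_in_ball disjoint_iff open_ball)
  then obtain u where u: "u \<in> ball y e" "u \<in> K" "a \<bullet> u \<noteq> b"
    using off[of "interior K \<inter> ball y e"] interior_subset by (metis IntD1 IntD2 open_Int open_ball open_interior subsetD)
  consider "a \<bullet> u < b" "a \<bullet> v > b" | "a \<bullet> u > b" "a \<bullet> v < b"
    using same[OF u(1) v(1)] u v by linarith
  then show ?thesis
  proof cases
    case 1
    have "x \<in> K" if "x \<in> ball y e" "a \<bullet> x < b" for x using same[OF u(1) that(1)] 1 that u by blast
    moreover have "x \<notin> K" if "x \<in> ball y e" "a \<bullet> x > b" for x using same[OF v(1) that(1)] 1 that v by blast
    ultimately show ?thesis by (rule regular_boundary_pointI[OF assms(2-5)])
  next
    case 2
    have "x \<in> K" if "x \<in> ball y e" "- a \<bullet> x < - b" for x using same[OF u(1) that(1)] 2 that u by simp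
    moreover have "x \<notin> K" if "x \<in> ball y e" "- a \<bullet> x > - b" for x using same[OF v(1) that(1)] 2 that v by simp
    ultimately have "regular_boundary_point (interior K) y (- a /\<^sub>R norm (- a))"
      using assms(4,5) by (intro regular_boundary_pointI[OF assms(2-3), of "- a" "- b"]) auto
    then show ?thesis using regular_boundary_point_uminus[of "interior K" y "a /\<^sub>R norm a"] by simp
  qed
qed

text \<open>A generic segment from the interior to the exterior leaves the interior at a point that lies on only
  one of the hyperplanes bounding the pieces, hence at a regular boundary point. The auxiliary hyperplanes
  span the base point \<open>u\<close> and the intersection of two of the bounding hyperplanes.\<close>

lemma frontier_in_facet_hyperplanes:
  fixes K :: "'a::euclidean_space set"
  assumes "finite \<C>" "\<And>C. C \<in> \<C> \<Longrightarrow> polyhedron C" "K = \<Union>\<C>"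
  obtains H where "finite H" "\<forall>(x, n)\<in>H. regular_boundary_point (interior K) x n"
    "\<And>y. y \<in> frontier (interior K) \<Longrightarrow> \<exists>(x, n)\<in>H. n \<bullet> (y - x) = 0"
proof -
  obtain L where L: "finite L" and L0: "\<And>a b. (a, b) \<in> L \<Longrightarrow> a \<noteq> 0" and
    LK: "\<And>x y. (\<And>a b. (a, b) \<in> L \<Longrightarrow> a \<bullet> x \<le> b \<longleftrightarrow> a \<bullet> y \<le> b) \<Longrightarrow> x \<in> K \<longleftrightarrow> y \<in> K"
    using finite_union_polyhedra_inequalities[OF assms] by metis
  have "closed K" unfolding assms(3) using assms(1,2) by (simp add: closed_Union polyhedron_imp_closed)
  \<comment> \<open>The inequalities whose hyperplane carries a facet, witnessed by a regular
    boundary point on it.\<close>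
  define M where "M = {(a, b) \<in> L. \<exists>x. a \<bullet> x = b \<and> regular_boundary_point (interior K) x (a /\<^sub>R norm a)}"
  have M: "finite M" "M \<subseteq> L" using L by (auto simp: M_def intro: finite_subset)
  have cover: "\<exists>(a, b)\<in>M. a \<bullet> y = b" if y: "y \<in> frontier (interior K)" for y
  proof (rule ccontr)
    assume "\<not> ?thesis"
    then have off_M: "a \<bullet> y \<noteq> b" if "(a, b) \<in> M" for a b using that by blast
    obtain e where "e > 0" and e: "\<And>a b x. (a, b) \<in> M \<Longrightarrow> a \<bullet> y \<noteq> b \<Longrightarrow> x \<in> ball y e \<Longrightarrow> a \<bullet> x \<le> b \<longleftrightarrow> a \<bullet> y \<le> b"
      using inequalities_locally_constant[OF M(1)] by blast
    \<comment> \<open>The negated inequalities control \<open>\<ge>\<close> as well as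
      \<open>\<le>\<close>; together they keep the hyperplanes of \<open>M\<close> away from the
      whole ball \<open>B\<close>.\<close>
    obtain e' where "e' > 0" and e': "\<And>a b x. (a, b) \<in> (\<lambda>(a, b). (- a, - b)) ` M \<Longrightarrow> a \<bullet> y \<noteq> b \<Longrightarrow> x \<in> ball y e' \<Longrightarrow> a \<bullet> x \<le> b \<longleftrightarrow> a \<bullet> y \<le> b"
      using inequalities_locally_constant[OF finite_imageI[OF M(1)]] by blast
    define B where "B = ball y (min e e')"
    have B: "a \<bullet> x \<noteq> b" if "x \<in> B" "(a, b) \<in> M" for x a b
    proof -
      have "(- a, - b) \<in> (\<lambda>(a, b). (- a, - b)) ` M" using that(2) by force
      from e'[OF this, of x] e[OF that(2), of x] off_M[OF that(2)] that(1)
      show ?thesis unfolding B_def by auto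
    qed
    have y': "y \<notin> interior K" "y \<in> closure (interior K)" using y by (auto simp: frontier_def)
    have "y \<in> B" "open B" "convex B" using \<open>e > 0\<close> \<open>e' > 0\<close> by (auto simp: B_def)
    have "interior K \<inter> B \<noteq> {}"
      using y'(2) \<open>y \<in> B\<close> \<open>open B\<close> open_Int_closure_eq_empty[of B "interior K"]
      by (metis Int_commute disjoint_iff)
    moreover have "open (interior K \<inter> B)" using \<open>open B\<close> by blast
    ultimately obtain u where "u \<in> interior K \<inter> B" and u_off': "\<forall>(a, b)\<in>L. a \<bullet> u \<noteq> b"
      using L0 exists_off_hyperplanes[OF L, of "interior K \<inter> B"] by blast
    then have u: "u \<in> interior K" "u \<in> B" by auto
    have u_off: "a \<bullet> u \<noteq> b" if "(a, b) \<in> L" for a b using u_off' that by blast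
    \<comment> \<open>The weights make the combined affine function vanish at \<open>u\<close>. If
      it also vanished at a later point of the segment, it would vanish at \<open>w\<close>. Pairs
      with zero combined normal are discarded.\<close>
    define N where "N = {z \<in> (\<lambda>((a, b), (a', b')). ((a' \<bullet> u - b') *\<^sub>R a - (a \<bullet> u - b) *\<^sub>R a',
      (a' \<bullet> u - b') * b - (a \<bullet> u - b) * b')) ` (L \<times> L). fst z \<noteq> 0}"
    have "finite N" unfolding N_def using L by simp
    have "\<not> B \<subseteq> K" using \<open>y \<in> B\<close> \<open>open B\<close> y'(1) interior_maximal by blast
    then have "B - K \<noteq> {}" by blast
    moreover have "open (B - K)" using \<open>open B\<close> \<open>closed K\<close> by blast
    moreover have "a \<noteq> 0" if "(a, b) \<in> N" for a b using that unfolding N_def by force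
    ultimately obtain w where "w \<in> B - K" and w_off': "\<forall>(a, b)\<in>N. a \<bullet> w \<noteq> b"
      using exists_off_hyperplanes[OF \<open>finite N\<close>, of "B - K"] by blast
    then have w: "w \<in> B" "w \<notin> K" by auto
    have w_off: "a \<bullet> w \<noteq> b" if "(a, b) \<in> N" for a b using w_off' that by blast
    have "closed_segment u w \<inter> frontier (interior K) \<noteq> {}"
      using u w interior_subset by (intro connected_Int_frontier) auto
    then obtain x where x: "x \<in> closed_segment u w" and xf: "x \<in> frontier (interior K)" by blast
    have "x \<in> B" using x u(2) w(1) \<open>convex B\<close> closed_segment_subset by blast
    have x': "x \<notin> interior K" "x \<in> closure (interior K)" using xf by (auto simp: frontier_def)
    obtain \<tau> where \<tau>: "x = (1 - \<tau>) *\<^sub>R u + \<tau> *\<^sub>R w" using x by (auto simp: closed_segment_def)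
    have "\<tau> \<noteq> 0" using \<tau> x'(1) u(1) by auto
    obtain e1 where "e1 > 0" and e1: "\<And>a b v. (a, b) \<in> L \<Longrightarrow> a \<bullet> x \<noteq> b \<Longrightarrow> v \<in> ball x e1 \<Longrightarrow> a \<bullet> v \<le> b \<longleftrightarrow> a \<bullet> x \<le> b"
      using inequalities_locally_constant[OF L] by blast
    \<comment> \<open>Otherwise membership in \<open>K\<close> would be constant near
      \<open>x\<close>, and \<open>x\<close>, which lies in the closed set \<open>K\<close>, would
      be interior.\<close>
    have "\<exists>(a, b)\<in>L. a \<bullet> x = b"
    proof (rule ccontr)
      assume "\<not> ?thesis"
      then have *: "v \<in> K \<longleftrightarrow> x \<in> K" if "v \<in> ball x e1" for v
        using that e1 by (intro LK) blast
      have "x \<in> K" using x'(2) \<open>closed K\<close> by (meson closure_minimal interior_subset subsetD)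
      then have "ball x e1 \<subseteq> K" using * by blast
      then show False using x'(1) \<open>e1 > 0\<close> by (meson centre_in_ball interior_maximal open_ball subsetD)
    qed
    then obtain a b where ab: "(a, b) \<in> L" "a \<bullet> x = b" by blast
    \<comment> \<open>Two bounding hyperplanes through \<open>x\<close> must coincide: their
      combination vanishes at \<open>u\<close> and \<open>x\<close>, hence at \<open>w\<close>,
      which the choice of \<open>w\<close> permits only for a zero normal.\<close>
    have par: "\<exists>\<kappa>. \<kappa> \<noteq> 0 \<and> a' = \<kappa> *\<^sub>R a \<and> b' = \<kappa> * b" if a': "(a', b') \<in> L" "a' \<bullet> x = b'" for a' b'
    proof -
      define \<alpha> where "\<alpha> = a \<bullet> u - b"
      define \<alpha>' where "\<alpha>' = a' \<bullet> u - b'"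
      have nz: "\<alpha> \<noteq> 0" "\<alpha>' \<noteq> 0" using u_off[OF ab(1)] u_off[OF a'(1)] by (auto simp: \<alpha>_def \<alpha>'_def)
      have 1: "(1 - \<tau>) * \<alpha> + \<tau> * (a \<bullet> w - b) = 0"
        using ab(2) unfolding \<tau> \<alpha>_def by (simp add: inner_add_right algebra_simps)
      have 2: "(1 - \<tau>) * \<alpha>' + \<tau> * (a' \<bullet> w - b') = 0"
        using a'(2) unfolding \<tau> \<alpha>'_def by (simp add: inner_add_right algebra_simps)
      have "\<tau> * (\<alpha>' * (a \<bullet> w - b) - \<alpha> * (a' \<bullet> w - b')) = 0" using 1 2 by algebra
      then have "\<alpha>' * (a \<bullet> w - b) = \<alpha> * (a' \<bullet> w - b')" using \<open>\<tau> \<noteq> 0\<close> by simp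
      then have "(\<alpha>' *\<^sub>R a - \<alpha> *\<^sub>R a') \<bullet> w = \<alpha>' * b - \<alpha> * b'"
        by (simp add: inner_diff_left algebra_simps)
      moreover have "(\<alpha>' *\<^sub>R a - \<alpha> *\<^sub>R a', \<alpha>' * b - \<alpha> * b') \<in> N" if "\<alpha>' *\<^sub>R a - \<alpha> *\<^sub>R a' \<noteq> 0"
        using that ab(1) a'(1) unfolding N_def \<alpha>_def \<alpha>'_def by force
      ultimately have eq: "\<alpha>' *\<^sub>R a = \<alpha> *\<^sub>R a'" using w_off by force
      have a'eq: "a' = (\<alpha>' / \<alpha>) *\<^sub>R a"
        using arg_cong[OF eq, of "\<lambda>z. (1 / \<alpha>) *\<^sub>R z"] nz by simp
      have "\<alpha>' * (a \<bullet> x) = \<alpha> * (a' \<bullet> x)" using arg_cong[OF eq, of "\<lambda>z. z \<bullet> x"] by simp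
      then have "b' = (\<alpha>' / \<alpha>) * b" using ab a' nz by (simp add: field_simps)
      then show ?thesis using a'eq nz by (intro exI[of _ "\<alpha>' / \<alpha>"]) auto
    qed
    have "regular_boundary_point (interior K) x (a /\<^sub>R norm a)"
    proof (rule regular_boundary_point_on_single_hyperplane[OF \<open>closed K\<close> xf \<open>e1 > 0\<close> L0[OF ab(1)] ab(2)])
      fix v1 v2 assume v: "v1 \<in> ball x e1" "v2 \<in> ball x e1"
        "a \<bullet> v1 < b \<and> a \<bullet> v2 < b \<or> a \<bullet> v1 > b \<and> a \<bullet> v2 > b"
      show "v1 \<in> K \<longleftrightarrow> v2 \<in> K"
      proof (rule LK)
        fix a' b' assume a': "(a', b') \<in> L"
        show "a' \<bullet> v1 \<le> b' \<longleftrightarrow> a' \<bullet> v2 \<le> b'"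
        proof (cases "a' \<bullet> x = b'")
          case True
          then obtain \<kappa> where "\<kappa> \<noteq> 0" "a' = \<kappa> *\<^sub>R a" "b' = \<kappa> * b" using par a' by blast
          then show ?thesis using v(3) by (cases "\<kappa> > 0") (auto simp: mult_le_cancel_left)
        next
          case False
          then show ?thesis using e1[OF a'] v by blast
        qed
      qed
    qed
    \<comment> \<open>So a hyperplane of \<open>M\<close> meets \<open>B\<close> after all, at
      \<open>x\<close>.\<close>
    then have "(a, b) \<in> M" using ab by (auto simp: M_def)
    then show False using B[OF \<open>x \<in> B\<close>] ab(2) by blast
  qed
  have "\<exists>x. a \<bullet> x = b \<and> regular_boundary_point (interior K) x (a /\<^sub>R norm a)" if "(a, b) \<in> M" for a b
    using that by (auto simp: M_def)
  then obtain \<xi> where \<xi>: "\<And>a b. (a, b) \<in> M \<Longrightarrow>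
      a \<bullet> \<xi> a b = b \<and> regular_boundary_point (interior K) (\<xi> a b) (a /\<^sub>R norm a)" by metis
  show thesis
  proof (rule that[of "(\<lambda>(a, b). (\<xi> a b, a /\<^sub>R norm a)) ` M"])
    fix y assume "y \<in> frontier (interior K)"
    then obtain a b where ab: "(a, b) \<in> M" "a \<bullet> y = b" using cover by blast
    then have "(a /\<^sub>R norm a) \<bullet> (y - \<xi> a b) = 0" using \<xi> by (simp add: inner_diff_right)
    then show "\<exists>(x, n)\<in>(\<lambda>(a, b). (\<xi> a b, a /\<^sub>R norm a)) ` M. n \<bullet> (y - x) = 0"
      using ab(1) by force
  qed (use M \<xi> in auto)
qed

subsection \<open>Billiard reflections\<close>

lemma reflect_linear: "linear (reflect n)"
  by (rule linearI) (simp_all add: reflect_def algebra_simps)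

lemma inner_reflect: "norm n = 1 \<Longrightarrow> reflect n p \<bullet> n = - (p \<bullet> n)"
  by (simp add: reflect_def inner_diff_left norm_eq_1)

lemma norm_reflect:
  assumes "norm n = 1" shows "norm (reflect n p) = norm p"
proof -
  have "reflect n p \<bullet> reflect n p = p \<bullet> p"
    using assms unfolding reflect_def by (simp add: norm_eq_1 inner_commute algebra_simps)
  then show ?thesis by (simp add: norm_eq_sqrt_inner)
qed

lemma reflect_uminus: "reflect (- n) p = reflect n p"
  by (simp add: reflect_def)

text \<open>For fixed \<open>t\<close> both sides are polynomials in position and momentum. They
  agree near \<open>(c, 0)\<close>, because a small momentum keeps the whole segment in
  \<open>U\<close> even when \<open>t\<close> is large.\<close>

lemma flow_invariant_extension:
  fixes f :: "'a::euclidean_space \<Rightarrow> 'a \<Rightarrow> real"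
  assumes free: "\<And>q p t. closed_segment q (q + t *\<^sub>R p) \<subseteq> U \<Longrightarrow> f (q + t *\<^sub>R p) p = f q p"
    and "open U" "U \<noteq> {}" and F: "real_polynomial_function F" "\<And>q p. q \<in> U \<Longrightarrow> f q p = F (q, p)"
  shows "F (y + t *\<^sub>R p, p) = F (y, p)"
proof -
  obtain c \<epsilon>' where "\<epsilon>' > 0" "ball c \<epsilon>' \<subseteq> U" using assms(2,3) open_contains_ball by blast
  then obtain \<epsilon> where \<epsilon>: "\<epsilon> > 0" "ball c (2 * \<epsilon>) \<subseteq> U"
    by (metis field_sum_of_halves half_gt_zero mult_2)
  have "bounded_linear (\<lambda>z :: 'a \<times> 'a. (fst z + t *\<^sub>R snd z, snd z))"
    by (intro bounded_linear_intros)
  then have 1: "real_polynomial_function (\<lambda>z. F (fst z + t *\<^sub>R snd z, snd z))"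
    using F(1) polynomial_function_bounded_linear real_polynomial_function_comp by blast
  have op: "open (ball c \<epsilon> \<times> {p :: 'a. norm (t *\<^sub>R p) < \<epsilon>})"
    by (intro open_Times open_Collect_less continuous_intros) auto
  have "F (fst z + t *\<^sub>R snd z, snd z) = F z" if z: "z \<in> ball c \<epsilon> \<times> {p :: 'a. norm (t *\<^sub>R p) < \<epsilon>}" for z
  proof -
    obtain q p where qp: "z = (q, p)" "dist c q < \<epsilon>" "norm (t *\<^sub>R p) < \<epsilon>" using z by auto
    have "dist c (q + t *\<^sub>R p) \<le> dist c q + dist q (q + t *\<^sub>R p)" by (rule dist_triangle)
    also have "dist q (q + t *\<^sub>R p) = norm (t *\<^sub>R p)" by (simp add: dist_norm)
    finally have "q + t *\<^sub>R p \<in> ball c (2 * \<epsilon>)" "q \<in> ball c (2 * \<epsilon>)" using qp \<epsilon>(1) by auto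
    then have "closed_segment q (q + t *\<^sub>R p) \<subseteq> U" "q + t *\<^sub>R p \<in> U" "q \<in> U"
      using \<epsilon>(2) closed_segment_subset[OF _ _ convex_ball] by blast+
    then show ?thesis using free[of q t p] F(2) qp(1) by simp
  qed
  from real_polynomial_function_eqI_open[OF 1 F(1) op, of "(c, 0)", OF _ this, of "(y, p)"]
  show ?thesis using \<epsilon>(1) by simp
qed

text \<open>\<open>first_integral\<close> compares \<open>f\<close> at interior points before and
  after impact; the flow invariance of \<open>F\<close> slides both to the impact point. Every
  hyperplane point \<open>x'\<close> near \<open>x\<close> is again regular, with a smaller
  ball.\<close>

lemma bounce_invariant:
  fixes f :: "'a::euclidean_space \<Rightarrow> 'a \<Rightarrow> real"
  assumes F: "\<And>q p. q \<in> U \<Longrightarrow> f q p = F (q, p)" and flow: "\<And>y t p. F (y + t *\<^sub>R p, p) = F (y, p)"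
    and fi: "first_integral U f"
    and n: "norm n = 1" "U \<inter> ball x e = {y \<in> ball x e. n \<bullet> (y - x) < 0}"
    and x': "x' \<in> ball x e" "n \<bullet> (x' - x) = 0" and p: "p \<bullet> n > 0"
  shows "F (x', reflect n p) = F (x', p)"
proof -
  define e' where "e' = e - dist x x'"
  have "e' > 0" using x' by (simp add: e'_def)
  have ball: "ball x' e' \<subseteq> ball x e"
  proof
    fix y assume "y \<in> ball x' e'"
    then show "y \<in> ball x e" using dist_triangle[of x y x'] by (simp add: e'_def)
  qed
  have n_eq: "n \<bullet> (y - x') = n \<bullet> (y - x)" for y
    using x'(2) by (simp add: inner_diff_right)
  have U': "U \<inter> ball x' e' = {y \<in> ball x' e'. n \<bullet> (y - x') < 0}"
    using n(2) ball unfolding n_eq by blast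
  have in_U: "x' + s *\<^sub>R v \<in> U" if "n \<bullet> v * s < 0" "\<bar>s\<bar> * norm v < e'" for s v
  proof -
    have "x' + s *\<^sub>R v \<in> {y \<in> ball x' e'. n \<bullet> (y - x') < 0}"
      using that by (simp add: dist_norm mult.commute)
    then show ?thesis using U' by blast
  qed
  have "x' \<in> closure U"
    unfolding closure_approachable
  proof (intro allI impI)
    fix \<delta> :: real assume "\<delta> > 0"
    then have "x' + (- (min e' \<delta> / 2)) *\<^sub>R n \<in> U"
      using n(1) n(1)[unfolded norm_eq_1] \<open>e' > 0\<close> by (intro in_U) auto
    moreover have "dist (x' + (- (min e' \<delta> / 2)) *\<^sub>R n) x' < \<delta>"
      using n(1) \<open>e' > 0\<close> \<open>\<delta> > 0\<close> by (simp add: dist_norm)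
    ultimately show "\<exists>y\<in>U. dist y x' < \<delta>" by blast
  qed
  moreover have "x' \<notin> U" using U' \<open>e' > 0\<close> by (metis (no_types, lifting) IntI centre_in_ball diff_self inner_zero_right less_irrefl mem_Collect_eq)
  ultimately have reg: "regular_boundary_point U x' n"
    unfolding regular_boundary_point_def frontier_def using n(1) U' \<open>e' > 0\<close> interior_subset by blast
  \<comment> \<open>Both legs last \<open>t\<close>, short enough to stay in the ball around
    \<open>x'\<close>; the reflected leg is as long, since reflection preserves the norm.\<close>
  define t where "t = e' / (norm p + 1)"
  have "t > 0" using \<open>e' > 0\<close> by (simp add: t_def add_nonneg_pos)
  have "t * norm p = e' * (norm p / (norm p + 1))" by (simp add: t_def)
  also have "\<dots> < e'" using \<open>e' > 0\<close> by (simp add: pos_divide_less_eq add_nonneg_pos)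
  finally have t: "s * norm p < e'" if "s \<le> t" for s
    using that mult_right_mono[of s t "norm p"] by simp
  have before: "(x' - t *\<^sub>R p) + s *\<^sub>R p \<in> U" if "0 \<le> s" "s < t" for s
  proof -
    have eq: "(x' - t *\<^sub>R p) + s *\<^sub>R p = x' + (s - t) *\<^sub>R p" by (simp add: algebra_simps)
    have "\<bar>s - t\<bar> * norm p < e'" using that by (intro t) auto
    then show ?thesis unfolding eq using in_U[of p "s - t"] that p
      by (simp add: mult_pos_neg inner_commute)
  qed
  have after: "x' + s *\<^sub>R reflect n p \<in> U" if "0 < s" "s \<le> t" for s
  proof (rule in_U)
    show "n \<bullet> reflect n p * s < 0" using that p inner_reflect[OF n(1), of p]
      by (simp add: inner_commute[of n])
    show "\<bar>s\<bar> * norm (reflect n p) < e'" using that t[OF that(2)] n(1) by (simp add: norm_reflect)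
  qed
  have "f (x' + t *\<^sub>R reflect n p) (reflect n p) = f (x' - t *\<^sub>R p) p"
    using fi[unfolded first_integral_def, THEN conjunct2, rule_format, of t "x' - t *\<^sub>R p" p x' n "reflect n p" t]
      \<open>t > 0\<close> before after reg p by simp
  moreover have "f (x' + t *\<^sub>R reflect n p) (reflect n p) = F (x', reflect n p)"
    using after[of t] \<open>t > 0\<close> F flow by simp
  moreover have "f (x' - t *\<^sub>R p) p = F (x', p)"
    using before[of 0] \<open>t > 0\<close> F flow[of "x' - t *\<^sub>R p" t p] by simp
  ultimately show ?thesis by simp
qed

text \<open>If the line through \<open>y\<close> along \<open>p\<close> meets the hyperplane near
  \<open>x\<close>, then slide to the impact point, bounce, and slide by the same parameter along
  the reflected momentum: the end point is the mirror image of \<open>y\<close>. Such pairs contain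
  an open set.\<close>

lemma reflection_invariant_extension:
  fixes f :: "'a::euclidean_space \<Rightarrow> 'a \<Rightarrow> real"
  assumes F: "real_polynomial_function F" "\<And>q p. q \<in> U \<Longrightarrow> f q p = F (q, p)"
    and flow: "\<And>y t p. F (y + t *\<^sub>R p, p) = F (y, p)"
    and fi: "first_integral U f" and reg: "regular_boundary_point U x n"
  shows "F (x + reflect n (y - x), reflect n p) = F (y, p)"
proof -
  \<comment> \<open>It suffices to treat \<open>U\<close> on the negative side of \<open>n\<close>,
    since \<open>n\<close> and \<open>- n\<close> define the same reflection.\<close>
  have oriented: "F (x + reflect n (y - x), reflect n p) = F (y, p)"
    if n: "norm n = 1" "U \<inter> ball x e = {y \<in> ball x e. n \<bullet> (y - x) < 0}" and "e > 0" for n e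
  proof -
    interpret R: linear "reflect n" by (rule reflect_linear)
    have "bounded_linear (reflect n)" using reflect_linear linear_conv_bounded_linear by blast
    then have "bounded_linear (\<lambda>z. (reflect n (fst z), reflect n (snd z)))"
      by (intro bounded_linear_Pair bounded_linear_compose[OF _ bounded_linear_fst]
          bounded_linear_compose[OF _ bounded_linear_snd])
    then have *: "polynomial_function (\<lambda>z. (reflect n (fst z), reflect n (snd z)) + (x - reflect n x, 0))"
      by (rule polynomial_function_add[OF polynomial_function_bounded_linear polynomial_function_const])
    then have 1: "real_polynomial_function (\<lambda>z. F (x + reflect n (fst z - x), reflect n (snd z)))"
    proof -
      have "(x + reflect n (fst z - x), reflect n (snd z)) =
          (reflect n (fst z), reflect n (snd z)) + (x - reflect n x, 0)" for z
        by (simp add: R.diff)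
      then show ?thesis using real_polynomial_function_comp[OF F(1) *] by presburger
    qed
    \<comment> \<open>The point where the line through \<open>fst z\<close> along
      \<open>snd z\<close> meets the facet hyperplane.\<close>
    define h where "h = (\<lambda>z :: 'a \<times> 'a. fst z - (((fst z - x) \<bullet> n) / (snd z \<bullet> n)) *\<^sub>R snd z)"
    define S where "S = {z :: 'a \<times> 'a. snd z \<bullet> n > 0}"
    have "open S" unfolding S_def by (intro open_Collect_less continuous_intros)
    moreover have "continuous_on S h" unfolding h_def S_def by (intro continuous_intros) auto
    ultimately have op: "open (S \<inter> h -` ball x e)" by (intro continuous_open_preimage) auto
    have "F (x + reflect n (fst z - x), reflect n (snd z)) = F z" if z: "z \<in> S \<inter> h -` ball x e" for z
    proof -
      obtain y p where yp: "z = (y, p)" by force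
      define k where "k = (y - x) \<bullet> n / (p \<bullet> n)"
      define x' where "x' = y - k *\<^sub>R p"
      have p: "p \<bullet> n > 0" and x': "x' \<in> ball x e"
        using z by (auto simp: S_def h_def yp k_def x'_def)
      have "k * (p \<bullet> n) = (y - x) \<bullet> n" using p by (simp add: k_def)
      then have x'n: "n \<bullet> (x' - x) = 0"
        by (simp add: x'_def inner_diff_left inner_diff_right inner_commute)
      have "reflect n (x' - x) = x' - x" using x'n by (simp add: reflect_def inner_commute)
      moreover have "y - x = (x' - x) + k *\<^sub>R p" by (simp add: x'_def)
      ultimately have "x + reflect n (y - x) = x' + k *\<^sub>R reflect n p"
        by (simp only: R.add R.scale) simp
      then have "F (x + reflect n (y - x), reflect n p) = F (x', reflect n p)" using flow by simp
      also have "\<dots> = F (x', p)"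
        by (rule bounce_invariant[where U = U and f = f and n = n, OF F(2) flow fi n x' x'n p])
      also have "\<dots> = F (y, p)" using flow[of x' k p] by (simp add: x'_def)
      finally show ?thesis by (simp add: yp)
    qed
    from real_polynomial_function_eqI_open[OF 1 F(1) op, of "(x, n)", OF _ this, of "(y, p)"]
    show ?thesis using \<open>e > 0\<close> n(1)[unfolded norm_eq_1] by (simp add: S_def h_def)
  qed
  obtain e where e: "norm n = 1" "e > 0" and "U \<inter> ball x e = {y \<in> ball x e. n \<bullet> (y - x) < 0} \<or>
      U \<inter> ball x e = {y \<in> ball x e. n \<bullet> (y - x) > 0}"
    using reg unfolding regular_boundary_point_def by blast
  then consider "U \<inter> ball x e = {y \<in> ball x e. n \<bullet> (y - x) < 0}"
    | "U \<inter> ball x e = {y \<in> ball x e. (- n) \<bullet> (y - x) < 0}" by auto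
  then show ?thesis
    using oriented[of n e] oriented[of "- n" e] e by cases (simp_all add: reflect_uminus)
qed

section \<open>Folding positions and independence of the position\<close>

text \<open>The squared distance changes by four times the product in the assumption, which is
  negative when \<open>y\<close> and \<open>z\<close> lie on opposite sides.\<close>

lemma dist_reflect_less:
  assumes "norm n = 1" "((y - x) \<bullet> n) * ((z - x) \<bullet> n) < 0"
  shows "dist z (x + reflect n (y - x)) < dist z y"
proof -
  define a where "a = (y - x) \<bullet> n"
  have eq: "x + reflect n (y - x) - z = (y - z) - (2 * a) *\<^sub>R n" by (simp add: reflect_def a_def)
  have "(norm (x + reflect n (y - x) - z))\<^sup>2 = (norm (y - z))\<^sup>2 - 4 * a * ((y - z) \<bullet> n) + 4 * a\<^sup>2"
    unfolding eq power2_norm_eq_inner using assms(1)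
    by (simp add: inner_diff_left inner_diff_right inner_commute norm_eq_1 algebra_simps power2_eq_square)
  also have "(y - z) \<bullet> n = a - (z - x) \<bullet> n" by (simp add: a_def inner_diff_left)
  also have "(norm (y - z))\<^sup>2 - 4 * a * (a - (z - x) \<bullet> n) + 4 * a\<^sup>2 = (norm (y - z))\<^sup>2 + 4 * (a * ((z - x) \<bullet> n))"
    by (simp add: algebra_simps power2_eq_square)
  also have "\<dots> < (norm (y - z))\<^sup>2" using assms(2) by (simp add: a_def)
  finally have "norm (x + reflect n (y - x) - z) < norm (y - z)"
    by (rule power_less_imp_less_base) simp
  then show ?thesis by (simp add: dist_norm norm_minus_commute)
qed

text \<open>Among all \<open>(y', p')\<close> with \<open>\<bar>p'\<bar> = \<bar>p\<bar>\<close> and \<open>F (y', p') = F (y, p)\<close>, one with \<open>y'\<close> closest to a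
  generic interior point \<open>z\<close> has \<open>y'\<close> in the closure of \<open>U\<close>: otherwise the segment from \<open>z\<close> to \<open>y'\<close>
  crosses a facet hyperplane, and reflecting in it brings \<open>y'\<close> closer to \<open>z\<close>. Hence \<open>F\<close> is bounded
  in the position.\<close>

lemma reflection_invariant_imp_position_independent:
  fixes F :: "'a::euclidean_space \<times> 'a \<Rightarrow> real"
  assumes F: "real_polynomial_function F" and U: "open U" "U \<noteq> {}" "bounded U"
    and H: "finite H" "\<And>x n. (x, n) \<in> H \<Longrightarrow> norm n = 1"
    and cover: "\<And>y. y \<in> frontier U \<Longrightarrow> \<exists>(x, n)\<in>H. n \<bullet> (y - x) = 0"
    and inv: "\<And>x n y p. (x, n) \<in> H \<Longrightarrow> F (x + reflect n (y - x), reflect n p) = F (y, p)"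
  shows "F (y, p) = F (y', p)"
proof -
  have "\<forall>(a, b)\<in>(\<lambda>(x, n). (n, n \<bullet> x)) ` H. a \<noteq> 0" using H(2) by force
  \<comment> \<open>A centre on a hyperplane would see no change of distance under its reflection;
    off all of them the decrease is strict.\<close>
  then obtain z where "z \<in> U" and z': "\<forall>(a, b)\<in>(\<lambda>(x, n). (n, n \<bullet> x)) ` H. a \<bullet> z \<noteq> b"
    using exists_off_hyperplanes[OF finite_imageI[OF H(1)], of _ U] U by blast
  have z: "n \<bullet> (z - x) \<noteq> 0" if "(x, n) \<in> H" for x n
    using z' that by (force simp: inner_diff_right)
  have cont: "continuous_on A F" for A
    using F continuous_on_polymonial_function real_polynomial_function_eq by blast
  have "compact (closure U \<times> sphere (0 :: 'a) (norm p))"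
    using U(3) by (intro compact_Times) (auto simp: compact_closure)
  then have "bounded (F ` (closure U \<times> sphere 0 (norm p)))"
    using cont compact_continuous_image compact_imp_bounded by blast
  then obtain M where M: "\<And>w. w \<in> closure U \<times> sphere 0 (norm p) \<Longrightarrow> \<bar>F w\<bar> \<le> M"
    unfolding bounded_iff by force
  have bound: "\<bar>F (y, p)\<bar> \<le> M" for y
  proof -
    \<comment> \<open>The competitor \<open>(y, p)\<close> allows cutting down to
      \<open>cball z (dist z y)\<close>, which makes the level set compact.\<close>
    define A where "A = (cball z (dist z y) \<times> sphere 0 (norm p)) \<inter> F -` {F (y, p)}"
    have "closed A" unfolding A_def
      by (intro continuous_closed_preimage cont closed_Times) auto
    moreover have "bounded A" unfolding A_def
      by (intro bounded_Int disjI1 bounded_Times) auto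
    ultimately have "compact A" by (simp add: compact_eq_bounded_closed)
    moreover have "(y, p) \<in> A" by (simp add: A_def)
    ultimately obtain w where w: "w \<in> A" and min: "\<And>v. v \<in> A \<Longrightarrow> dist z (fst w) \<le> dist z (fst v)"
      using continuous_attains_inf[of A "\<lambda>w. dist z (fst w)"]
        continuous_on_dist[OF continuous_on_const continuous_on_fst[OF continuous_on_id]] by blast
    obtain u q where uq: "w = (u, q)" by force
    have u: "dist z u \<le> dist z y" "norm q = norm p" "F (u, q) = F (y, p)"
      using w by (auto simp: A_def uq)
    have "u \<in> closure U"
    proof (rule ccontr)
      assume "u \<notin> closure U"
      then have "u \<notin> U" using closure_subset by blast
      then have "closed_segment z u \<inter> frontier U \<noteq> {}"
        using \<open>z \<in> U\<close> by (intro connected_Int_frontier) auto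
      then obtain v where v: "v \<in> closed_segment z u" "v \<in> frontier U" by blast
      then obtain x n where xn: "(x, n) \<in> H" "n \<bullet> (v - x) = 0" using cover by blast
      obtain \<tau> where \<tau>: "v = (1 - \<tau>) *\<^sub>R z + \<tau> *\<^sub>R u" "0 \<le> \<tau>" "\<tau> \<le> 1"
        using v(1) by (auto simp: closed_segment_def)
      have "v \<noteq> u" using v(2) \<open>u \<notin> closure U\<close> by (auto simp: frontier_def)
      then have "\<tau> < 1" using \<tau> by (cases "\<tau> = 1") auto
      have eq: "(1 - \<tau>) * ((z - x) \<bullet> n) + \<tau> * ((u - x) \<bullet> n) = 0"
        using xn(2) unfolding \<tau>(1) by (simp add: inner_add_right inner_diff_left inner_diff_right inner_commute algebra_simps)
      have nz: "(z - x) \<bullet> n \<noteq> 0" using z[OF xn(1)] by (simp add: inner_commute)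
      have "\<tau> \<noteq> 0" using eq nz by auto
      then have "\<tau> > 0" using \<tau>(2) by simp
      \<comment> \<open>The hyperplane point \<open>v\<close> lies strictly between \<open>z\<close>
        and \<open>u\<close>, so these are on opposite sides; the relation \<open>eq\<close> is
        multiplied by \<open>(z - x) \<bullet> n\<close>.\<close>
      have "\<tau> * (((u - x) \<bullet> n) * ((z - x) \<bullet> n)) = - (1 - \<tau>) * ((z - x) \<bullet> n)\<^sup>2"
        using eq by (simp add: power2_eq_square) algebra
      also have "\<dots> < 0" using \<open>\<tau> < 1\<close> nz by (simp add: mult_neg_pos)
      finally have "((u - x) \<bullet> n) * ((z - x) \<bullet> n) < 0" using \<open>\<tau> > 0\<close> by (simp add: mult_less_0_iff)
      then have less: "dist z (x + reflect n (u - x)) < dist z u"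
        by (intro dist_reflect_less H(2)[OF xn(1)])
      then have "(x + reflect n (u - x), reflect n q) \<in> A"
        using u inv[OF xn(1)] H(2)[OF xn(1)] by (simp add: A_def norm_reflect)
      from min[OF this] less show False by (simp add: uq)
    qed
    then show ?thesis using M[of "(u, q)"] u by simp
  qed
  obtain P where P: "\<And>t. F ((y, p) + t *\<^sub>R (y' - y, 0)) = poly P t"
    using real_polynomial_function_on_line[OF F] by blast
  have "\<bar>poly P t\<bar> \<le> M" for t using bound[of "y + t *\<^sub>R (y' - y)"] P[of t] by simp
  then have "poly P 0 = poly P 1" by (rule bounded_poly_constant)
  then show ?thesis using P[of 0] P[of 1] by simp
qed

section \<open>Invariant polynomials in the momentum\<close>

lemma poly_even_odd_parts:
  fixes R :: "'a::comm_semiring_1 poly"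
  shows "\<exists>A B. \<forall>t. poly R t = poly A (t\<^sup>2) + t * poly B (t\<^sup>2)"
proof (induction R)
  case 0
  show ?case by (intro exI[of _ 0]) simp
next
  case (pCons a R)
  then obtain A B where "poly R t = poly A (t\<^sup>2) + t * poly B (t\<^sup>2)" for t by blast
  then show ?case
    by (intro exI[of _ "pCons a B"] exI[of _ A]) (simp add: algebra_simps power2_eq_square)
qed

text \<open>Orthogonal maps act transitively on spheres, so \<open>Q\<close> is determined on a line
  through 0. Averaging over \<open>t\<close> and \<open>- t\<close> removes the odd part and leaves
  a polynomial in the squared norm; \<open>[:0, 2:]\<close> rescales to the kinetic energy.\<close>

lemma orthogonal_invariant_polynomial:
  fixes Q :: "real^'n \<Rightarrow> real"
  assumes Q: "real_polynomial_function Q"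
    and inv: "\<And>A p. orthogonal_matrix A \<Longrightarrow> Q (A *v p) = Q p"
  shows "\<exists>P. \<forall>p. Q p = poly P ((norm p)\<^sup>2 / 2)"
proof -
  define u :: "real^'n" where "u = axis undefined 1"
  have u: "norm u = 1" by (simp add: u_def)
  obtain R where "Q (0 + t *\<^sub>R u) = poly R t" for t
    using real_polynomial_function_on_line[OF Q] by blast
  then have R: "Q (t *\<^sub>R u) = poly R t" for t by simp
  have same: "Q a = Q b" if "norm a = norm b" for a b
  proof -
    obtain g where g: "orthogonal_transformation g" "g a = b"
      using orthogonal_transformation_exists[OF \<open>norm a = norm b\<close>] by metis
    then have "orthogonal_matrix (matrix g)" "matrix g *v a = b"
      by (auto simp: orthogonal_transformation_matrix matrix_works orthogonal_transformation_linear)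
    then show ?thesis using inv by metis
  qed
  obtain A B where AB: "\<And>t. poly R t = poly A (t\<^sup>2) + t * poly B (t\<^sup>2)"
    using poly_even_odd_parts by blast
  have "Q p = poly (pcompose A [:0, 2:]) ((norm p)\<^sup>2 / 2)" for p
  proof -
    have "Q p = Q (norm p *\<^sub>R u)" "Q p = Q ((- norm p) *\<^sub>R u)" using u by (auto intro!: same)
    then have "2 * Q p = poly R (norm p) + poly R (- norm p)" by (simp only: R)
    then have "Q p = poly A ((norm p)\<^sup>2)" by (simp add: AB)
    then show ?thesis by (simp add: poly_pcompose)
  qed
  then show ?thesis by blast
qed

text \<open>Invariance passes from the reflections to the generated group by induction, and to its
  closure because, for each \<open>p\<close>, the matrices \<open>A\<close> with
  \<open>Q (A *v p) = Q p\<close> form a closed set.\<close>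

lemma billiard_group_invariant:
  fixes Q :: "real^'n \<Rightarrow> real"
  assumes Q: "continuous_on UNIV Q"
    and refl: "\<And>x n p. regular_boundary_point (interior K) x n \<Longrightarrow> Q (reflect n p) = Q p"
    and g: "g \<in> billiard_group K"
  shows "Q (g *v p) = Q p"
proof -
  interpret G: group "O_group :: (real^'n^'n) monoid" by (rule group_O_group)
  have gen: "\<forall>p. Q (A *v p) = Q p" if "A \<in> generate O_group (facet_reflections K)" for A
    using that
  proof induction
    case one
    show ?case by (simp add: O_group_def)
  next
    case (incl h)
    then show ?case using refl by (auto simp: facet_reflections_def matrix_works reflect_linear)
  next
    case (inv h)
    then have h: "h \<in> carrier O_group" using facet_reflections_subset by blast
    have "h ** (inv\<^bsub>O_group\<^esub> h) = mat 1"
      using G.r_inv[OF h] by (simp add: O_group_def)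
    then have "h *v ((inv\<^bsub>O_group\<^esub> h) *v p) = p" for p
      by (simp add: matrix_vector_mul_assoc)
    moreover have "Q (h *v p) = Q p" for p
      using inv refl by (auto simp: facet_reflections_def matrix_works reflect_linear)
    ultimately show ?case by metis
  next
    case (eng h1 h2)
    then show ?case by (simp add: O_group_def flip: matrix_vector_mul_assoc)
  qed
  define C where "C = {A :: real^'n^'n. Q (A *v p) = Q p}"
  have "linear (\<lambda>A :: real^'n^'n. A *v p)"
    by (rule linearI) (simp_all add: matrix_vector_mult_add_rdistrib scaleR_matrix_vector_assoc)
  then have "continuous_on UNIV (\<lambda>A :: real^'n^'n. A *v p)" by (rule linear_continuous_on[OF linear_conv_bounded_linear[THEN iffD1]])
  then have "continuous_on UNIV (\<lambda>A. Q (A *v p))"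
    using continuous_on_compose2[OF Q] by blast
  then have "closed C" unfolding C_def by (intro closed_Collect_eq continuous_on_const)
  show ?thesis
  proof (rule ccontr)
    assume "Q (g *v p) \<noteq> Q p"
    moreover have "g \<in> carrier O_group"
      using g unfolding billiard_group_def in_closure_of by simp
    ultimately have "g \<in> carrier O_group \<inter> - C" by (simp add: C_def)
    moreover have "openin (top_of_set (carrier O_group)) (carrier O_group \<inter> - C)"
      using \<open>closed C\<close> by (intro openin_open_Int) auto
    moreover have "\<forall>T. g \<in> T \<and> openin (top_of_set (carrier O_group)) T \<longrightarrow>
        (\<exists>A\<in>generate O_group (facet_reflections K). A \<in> T)"
      using g unfolding billiard_group_def in_closure_of Bex_def by (elim conjE)
    ultimately obtain A where "A \<in> generate O_group (facet_reflections K)" "A \<in> carrier O_group \<inter> - C"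
      by (elim allE[of _ "carrier O_group \<inter> - C"]) blast
    then show False using gen by (auto simp: C_def)
  qed
qed

theorem theorem1:
  fixes K :: "(real^'n) set" and f :: "real^'n \<Rightarrow> real^'n \<Rightarrow> real"
  assumes "CARD('n) \<ge> 2"
    and "nonconvex_polytope K" and "bounded K" and "interior K \<noteq> {}"
    and "first_integral (interior K) f"
    and "polynomial_in_momentum (interior K) f"
  shows "\<exists>Q :: real^'n \<Rightarrow> real. real_polynomial_function Q \<and>
           (\<forall>q\<in>interior K. \<forall>p. f q p = Q p) \<and>
           (\<forall>g\<in>billiard_group K. \<forall>p. Q (g *v p) = Q p) \<and>
           (billiard_group K = carrier O_group \<longrightarrow>
              (\<exists>P :: real poly. \<forall>q\<in>interior K. \<forall>p. f q p = poly P ((norm p)\<^sup>2 / 2)))"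
proof -
  have free: "f (q + t *\<^sub>R p) p = f q p" if "closed_segment q (q + t *\<^sub>R p) \<subseteq> interior K" for q p t
    using assms(5) that unfolding first_integral_def by blast
  obtain r where mom: "\<And>q p v. q \<in> interior K \<Longrightarrow>
      \<exists>P. degree P \<le> r \<and> (\<forall>t. f q (p + t *\<^sub>R v) = poly P t)"
    using polynomial_in_momentum_on_line[OF assms(6)] by blast
  obtain \<C> where \<C>: "finite \<C>" "\<And>C. C \<in> \<C> \<Longrightarrow> polyhedron C" "K = \<Union>\<C>" and "connected (interior K)"
    using assms(2) unfolding nonconvex_polytope_def by blast
  have "\<exists>F. real_polynomial_function F \<and> (\<forall>q\<in>interior K. \<forall>p. f q p = F (q, p))"
    by (rule first_integral_polynomial[where r = r])
      (fact free mom open_interior \<open>connected (interior K)\<close>)+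
  then obtain F where F: "real_polynomial_function F" "\<And>q p. q \<in> interior K \<Longrightarrow> f q p = F (q, p)"
    by blast
  have flow: "F (y + t *\<^sub>R p, p) = F (y, p)" for y t p
    by (rule flow_invariant_extension[OF free open_interior assms(4) F])
  have refl: "F (x + reflect n (y - x), reflect n p) = F (y, p)"
    if "regular_boundary_point (interior K) x n" for x n y p
    by (rule reflection_invariant_extension[OF F flow assms(5) that])
  obtain H where H: "finite H" "\<forall>(x, n)\<in>H. regular_boundary_point (interior K) x n"
    "\<And>y. y \<in> frontier (interior K) \<Longrightarrow> \<exists>(x, n)\<in>H. n \<bullet> (y - x) = 0"
    using frontier_in_facet_hyperplanes[OF \<C>] by blast
  have reg: "regular_boundary_point (interior K) x n" if "(x, n) \<in> H" for x n
    using H(2) that by blast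
  have bdd: "bounded (interior K)" using assms(3) bounded_interior by blast
  have unit: "norm n = 1" if "(x, n) \<in> H" for x n
    using reg[OF that] by (simp add: regular_boundary_point_def)
  have inv_H: "F (x + reflect n (y - x), reflect n p) = F (y, p)" if "(x, n) \<in> H" for x n y p
    by (rule refl[OF reg[OF that]])
  have indep: "F (y, p) = F (0, p)" for y p
    by (rule reflection_invariant_imp_position_independent[where U = "interior K" and H = H])
      (fact F(1) open_interior assms(4) bdd H(1) unit H(3) inv_H)+
  define Q where "Q = (\<lambda>p. F (0, p))"
  have "polynomial_function (\<lambda>p :: real^'n. (0 :: real^'n, p))"
    by (intro polynomial_function_bounded_linear bounded_linear_intros)
  then have Q: "real_polynomial_function Q"
    unfolding Q_def by (rule real_polynomial_function_comp[OF F(1)])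
  have fQ: "f q p = Q p" if "q \<in> interior K" for q p
    using F(2)[OF that] indep by (simp add: Q_def)
  \<comment> \<open>Independence of the position discards the affine part of the reflection and
    leaves its linear part.\<close>
  have "Q (reflect n p) = Q p" if "regular_boundary_point (interior K) x n" for x n p
    using refl[OF that, of 0 p] indep unfolding Q_def by metis
  moreover have "continuous_on UNIV Q"
    using Q continuous_on_polymonial_function real_polynomial_function_eq by blast
  ultimately have inv: "Q (g *v p) = Q p" if "g \<in> billiard_group K" for g p
    using billiard_group_invariant that by blast
  have "\<exists>P. \<forall>p. Q p = poly P ((norm p)\<^sup>2 / 2)" if "billiard_group K = carrier O_group"
    using inv that by (intro orthogonal_invariant_polynomial[OF Q]) (simp add: O_group_def)
  then have "billiard_group K = carrier O_group \<longrightarrow>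
      (\<exists>P. \<forall>q\<in>interior K. \<forall>p. f q p = poly P ((norm p)\<^sup>2 / 2))"
    using fQ by auto
  then show ?thesis using Q fQ inv by blast
qed

end
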